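(* Every five-dimensional Tuba-Wenzl representation of $\mathcal{B}_3$ admits a standard extension to $\mathcal{LB}_3$. In particular, every irreducible five-dimensional complex representation of $\mathcal{B}_3$ admits a standard extension to $\mathcal{LB}_3$.
   Context: $\mathcal{B}_3=\langle \sigma_1,\sigma_2 : \sigma_1\sigma_2\sigma_1=\sigma_2\sigma_1\sigma_2\rangle$ is the braid group. The three component loop braid group $\mathcal{LB}_3$ is the group generated by $\sigma_1,\sigma_2,s_1,s_2$ with relations $\sigma_1\sigma_2\sigma_1=\sigma_2\sigma_1\sigma_2$; $s_1s_2s_1=s_2s_1s_2$; $s_1^2=s_2^2=1$; $s_1s_2\sigma_1=\sigma_2s_1s_2$; $\sigma_1\sigma_2s_1=s_2\sigma_1\sigma_2$. An extension of a representation $\rho$ of $\mathcal{B}_3$ on $V$ to $\mathcal{LB}_3$ is a representation of $\mathcal{LB}_3$ on the same space with the same values on $\sigma_1,\sigma_2$; it is standard if $\rho(s_1s_2)=k\rho(\sigma_1\sigma_2)$ for some $k\in\mathbb{C}$. Five-dimensional Tuba-Wenzl representations: let $\lambda_1,\dots,\lambda_5\in\mathbb{C}^\times$ and let $\gamma$ be a fixed fifth root of $\lambda_1\lambda_2\lambda_3\lambda_4\lambda_5$. The representation is $\rho(\sigma_1)=A$, $\rho(\sigma_2)=B$, where $A$ is the upper triangular $5\times5$ matrix with diagonal entries $A_{ii}=\lambda_i$ and $A_{12}=(1+\frac{\gamma^2}{\lambda_2\lambda_4})(\lambda_2+\frac{\gamma^3}{\lambda_3\lambda_4})$, $A_{13}=(1+\frac{\lambda_1\lambda_5}{\gamma^2})(\lambda_3+\gamma+\frac{\gamma^2}{\lambda_3})$,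 $A_{14}=(1+\frac{\lambda_2\lambda_4}{\gamma^2})(\lambda_3+\frac{\gamma^3}{\lambda_2\lambda_4})$, $A_{15}=A_{25}=A_{35}=\frac{\gamma^3}{\lambda_1\lambda_5}$, $A_{23}=\lambda_3+\gamma+\frac{\gamma^2}{\lambda_3}$, $A_{24}=\lambda_3+\gamma+\frac{\gamma^3}{\lambda_1\lambda_5}$, $A_{34}=\lambda_3+\frac{\gamma^3}{\lambda_1\lambda_5}$, $A_{45}=\lambda_4$, and $B_{i,j}=(-1)^{i-j}A_{6-i,6-j}$. By Tuba and Wenzl these define representations of $\mathcal{B}_3$ (not necessarily irreducible), and every irreducible five-dimensional complex representation of $\mathcal{B}_3$ is equivalent to one of them. *)

theory Defs
  imports "HOL-Analysis.Analysis" "HOL-Algebra.Group"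
begin

section \<open>Groups given by generators and relations\<close>

text \<open>A letter \<open>(g, True)\<close> stands for the generator \<open>g\<close>, and \<open>(g, False)\<close> for its formal inverse.
  The elements of the presented group are the classes of words modulo the least congruence that
  contains the relations and free cancellation.\<close>

type_synonym 'g word = "('g \<times> bool) list"

definition pos :: "'g list \<Rightarrow> 'g word" where
  "pos gs = map (\<lambda>g. (g, True)) gs"

inductive pres_cong :: "('g word \<times> 'g word) set \<Rightarrow> 'g word \<Rightarrow> 'g word \<Rightarrow> bool"
  for R :: "('g word \<times> 'g word) set" where
  rel: "(u, v) \<in> R \<Longrightarrow> pres_cong R u v"
| cancel: "pres_cong R [(g, e), (g, \<not> e)] []"
| refl: "pres_cong R u u"
| sym: "pres_cong R u v \<Longrightarrow> pres_cong R v u"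
| trans: "pres_cong R u v \<Longrightarrow> pres_cong R v w \<Longrightarrow> pres_cong R u w"
| append: "pres_cong R u u' \<Longrightarrow> pres_cong R v v' \<Longrightarrow> pres_cong R (u @ v) (u' @ v')"

definition word_class :: "('g word \<times> 'g word) set \<Rightarrow> 'g word \<Rightarrow> 'g word set" where
  "word_class R u = {v. pres_cong R u v}"

definition presented_group :: "('g word \<times> 'g word) set \<Rightarrow> 'g word set monoid" where
  "presented_group R =
     \<lparr>carrier = range (word_class R),
      monoid.mult = (\<lambda>X Y. \<Union>x\<in>X. \<Union>y\<in>Y. word_class R (x @ y)),
      one = word_class R []\<rparr>"

lemma word_class_eq_iff: "word_class R u = word_class R v \<longleftrightarrow> pres_cong R u v"
  unfolding word_class_def using pres_cong.refl pres_cong.sym pres_cong.trans by blast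

lemma presented_group_mult:
  "word_class R u \<otimes>\<^bsub>presented_group R\<^esub> word_class R v = word_class R (u @ v)"
proof -
  have "word_class R (x @ y) = word_class R (u @ v)"
    if "x \<in> word_class R u" "y \<in> word_class R v" for x y
    using that unfolding word_class_eq_iff
    by (simp add: word_class_def pres_cong.sym[OF pres_cong.append])
  moreover have "u \<in> word_class R u" "v \<in> word_class R v"
    by (auto simp: word_class_def intro: pres_cong.refl)
  ultimately have "(\<Union>x\<in>word_class R u. \<Union>y\<in>word_class R v. word_class R (x @ y)) =
      word_class R (u @ v)"
    by blast
  then show ?thesis
    by (simp add: presented_group_def)
qed

lemma pres_cong_inverse:
  "pres_cong R (rev (map (\<lambda>(g, e). (g, \<not> e)) u) @ u) []"
proof (induction u)
  case Nil
  show ?case by (simp add: pres_cong.refl)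
next
  case (Cons a u)
  obtain g e where a: "a = (g, e)" by (cases a)
  let ?u = "rev (map (\<lambda>(g, e). (g, \<not> e)) u)"
  have "pres_cong R [(g, \<not> e), (g, e)] []"
    using pres_cong.cancel[of R g "\<not> e"] by simp
  then have "pres_cong R (?u @ ([(g, \<not> e), (g, e)] @ u)) (?u @ ([] @ u))"
    by (intro pres_cong.append pres_cong.refl)
  then have "pres_cong R (?u @ ([(g, \<not> e), (g, e)] @ u)) []"
    using pres_cong.trans[OF _ Cons] by simp
  then show ?case
    by (simp add: a)
qed

lemma group_presented_group: "group (presented_group R)"
proof (rule groupI)
  fix X assume "X \<in> carrier (presented_group R)"
  then obtain u where X: "X = word_class R u" by (auto simp: presented_group_def)
  have one: "\<one>\<^bsub>presented_group R\<^esub> = word_class R []" by (simp add: presented_group_def)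
  show "\<one>\<^bsub>presented_group R\<^esub> \<otimes>\<^bsub>presented_group R\<^esub> X = X"
    by (simp add: one X presented_group_mult)
  show "\<exists>Y\<in>carrier (presented_group R). Y \<otimes>\<^bsub>presented_group R\<^esub> X = \<one>\<^bsub>presented_group R\<^esub>"
  proof
    let ?Y = "word_class R (rev (map (\<lambda>(g, e). (g, \<not> e)) u))"
    show "?Y \<otimes>\<^bsub>presented_group R\<^esub> X = \<one>\<^bsub>presented_group R\<^esub>"
      by (simp add: one X presented_group_mult word_class_eq_iff pres_cong_inverse)
    show "?Y \<in> carrier (presented_group R)"
      by (simp add: presented_group_def)
  qed
next
  fix X Y assume "X \<in> carrier (presented_group R)" "Y \<in> carrier (presented_group R)"
  then obtain u v where "X = word_class R u" "Y = word_class R v"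
    by (auto simp: presented_group_def)
  then show "X \<otimes>\<^bsub>presented_group R\<^esub> Y \<in> carrier (presented_group R)"
    by (simp add: presented_group_mult) (simp add: presented_group_def)
next
  fix X Y Z assume "X \<in> carrier (presented_group R)" "Y \<in> carrier (presented_group R)"
    "Z \<in> carrier (presented_group R)"
  then obtain u v w where "X = word_class R u" "Y = word_class R v" "Z = word_class R w"
    by (auto simp: presented_group_def)
  then show "X \<otimes>\<^bsub>presented_group R\<^esub> Y \<otimes>\<^bsub>presented_group R\<^esub> Z =
      X \<otimes>\<^bsub>presented_group R\<^esub> (Y \<otimes>\<^bsub>presented_group R\<^esub> Z)"
    by (simp add: presented_group_mult)
qed (simp add: presented_group_def)


section \<open>The groups \<open>B\<^sub>3\<close> and \<open>LB\<^sub>3\<close>\<close>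

datatype braid_gen = Sigma1 | Sigma2

definition B3_relations :: "(braid_gen word \<times> braid_gen word) set" where
  "B3_relations = {(pos [Sigma1, Sigma2, Sigma1], pos [Sigma2, Sigma1, Sigma2])}"

definition B3 :: "braid_gen word set monoid" where
  "B3 = presented_group B3_relations"

definition B3_gen :: "braid_gen \<Rightarrow> braid_gen word set" where
  "B3_gen g = word_class B3_relations (pos [g])"

datatype loop_braid_gen = LSigma1 | LSigma2 | S1 | S2

definition LB3_relations :: "(loop_braid_gen word \<times> loop_braid_gen word) set" where
  "LB3_relations =
     {(pos [LSigma1, LSigma2, LSigma1], pos [LSigma2, LSigma1, LSigma2]),
      (pos [S1, S2, S1], pos [S2, S1, S2]),
      (pos [S1, S1], []),
      (pos [S2, S2], []),
      (pos [S1, S2, LSigma1], pos [LSigma2, S1, S2]),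
      (pos [LSigma1, LSigma2, S1], pos [S2, LSigma1, LSigma2])}"

definition LB3 :: "loop_braid_gen word set monoid" where
  "LB3 = presented_group LB3_relations"

definition LB3_gen :: "loop_braid_gen \<Rightarrow> loop_braid_gen word set" where
  "LB3_gen g = word_class LB3_relations (pos [g])"


section \<open>Complex representations\<close>

text \<open>The representation space is the whole type \<open>'v\<close> with scalar multiplication \<open>scl\<close>.\<close>

definition GL :: "(complex \<Rightarrow> 'v::ab_group_add \<Rightarrow> 'v) \<Rightarrow> ('v \<Rightarrow> 'v) monoid" where
  "GL scl =
     \<lparr>carrier = {f. Vector_Spaces.linear scl scl f \<and> bij f},
      monoid.mult = (\<circ>),
      one = id\<rparr>"

definition representation ::
  "'g monoid \<Rightarrow> (complex \<Rightarrow> 'v::ab_group_add \<Rightarrow> 'v) \<Rightarrow> ('g \<Rightarrow> 'v \<Rightarrow> 'v) \<Rightarrow> bool" where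
  "representation G scl \<rho> \<longleftrightarrow> vector_space scl \<and> \<rho> \<in> hom G (GL scl)"

definition irreducible_representation ::
  "'g monoid \<Rightarrow> (complex \<Rightarrow> 'v::ab_group_add \<Rightarrow> 'v) \<Rightarrow> ('g \<Rightarrow> 'v \<Rightarrow> 'v) \<Rightarrow> bool" where
  "irreducible_representation G scl \<rho> \<longleftrightarrow>
     representation G scl \<rho> \<and> (UNIV :: 'v set) \<noteq> {0} \<and>
     (\<forall>W. module.subspace scl W \<and> (\<forall>g\<in>carrier G. \<forall>v\<in>W. \<rho> g v \<in> W) \<longrightarrow> W = {0} \<or> W = UNIV)"

definition is_extension ::
  "(complex \<Rightarrow> 'v::ab_group_add \<Rightarrow> 'v) \<Rightarrow> (braid_gen word set \<Rightarrow> 'v \<Rightarrow> 'v) \<Rightarrow>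
    (loop_braid_gen word set \<Rightarrow> 'v \<Rightarrow> 'v) \<Rightarrow> bool" where
  "is_extension scl \<rho> \<rho>' \<longleftrightarrow>
     representation LB3 scl \<rho>' \<and>
     \<rho>' (LB3_gen LSigma1) = \<rho> (B3_gen Sigma1) \<and>
     \<rho>' (LB3_gen LSigma2) = \<rho> (B3_gen Sigma2)"

definition is_standard_extension ::
  "(complex \<Rightarrow> 'v::ab_group_add \<Rightarrow> 'v) \<Rightarrow> (braid_gen word set \<Rightarrow> 'v \<Rightarrow> 'v) \<Rightarrow>
    (loop_braid_gen word set \<Rightarrow> 'v \<Rightarrow> 'v) \<Rightarrow> bool" where
  "is_standard_extension scl \<rho> \<rho>' \<longleftrightarrow>
     is_extension scl \<rho> \<rho>' \<and>
     (\<exists>k. \<rho>' (LB3_gen S1 \<otimes>\<^bsub>LB3\<^esub> LB3_gen S2) =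
        (\<lambda>v. scl k (\<rho> (B3_gen Sigma1 \<otimes>\<^bsub>B3\<^esub> B3_gen Sigma2) v)))"

definition admits_standard_extension ::
  "(complex \<Rightarrow> 'v::ab_group_add \<Rightarrow> 'v) \<Rightarrow> (braid_gen word set \<Rightarrow> 'v \<Rightarrow> 'v) \<Rightarrow> bool" where
  "admits_standard_extension scl \<rho> \<longleftrightarrow> (\<exists>\<rho>'. is_standard_extension scl \<rho> \<rho>')"


section \<open>Five-dimensional Tuba-Wenzl representations\<close>

text \<open>The entries \<open>a i j\<close> are indexed by natural numbers \<open>1, \<dots>, 5\<close>, since arithmetic on indices and
  parities are meaningless in the index type \<open>5\<close>, where \<open>5 = 0\<close>.\<close>

definition matrix5 :: "(nat \<Rightarrow> nat \<Rightarrow> complex) \<Rightarrow> complex^5^5" where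
  "matrix5 a = vector (map (\<lambda>i. vector (map (\<lambda>j. a i j) [1..<6])) [1..<6])"

lemma vector5_nth:
  "(vector [a, b, c, d, e] :: 'a::zero^5) $ 1 = a"
  "(vector [a, b, c, d, e] :: 'a::zero^5) $ 2 = b"
  "(vector [a, b, c, d, e] :: 'a::zero^5) $ 3 = c"
  "(vector [a, b, c, d, e] :: 'a::zero^5) $ 4 = d"
  "(vector [a, b, c, d, e] :: 'a::zero^5) $ 5 = e"
  unfolding vector_def by simp_all

lemma matrix5_nth:
  assumes "i \<in> {1..5}" "j \<in> {1..5}"
  shows "matrix5 a $ of_nat i $ of_nat j = a i j"
proof -
  have i: "i = 1 \<or> i = 2 \<or> i = 3 \<or> i = 4 \<or> i = 5"
    using assms(1) unfolding atLeastAtMost_iff by presburger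
  have j: "j = 1 \<or> j = 2 \<or> j = 3 \<or> j = 4 \<or> j = 5"
    using assms(2) unfolding atLeastAtMost_iff by presburger
  have upt: "[1..<6] = [1, 2, 3, 4, 5 :: nat]"
    by (simp add: upt_conv_Cons)
  have nth: "vector (map f [1..<6]) $ (of_nat n :: 5) = f n"
    if "n = 1 \<or> n = 2 \<or> n = 3 \<or> n = 4 \<or> n = 5" for n and f :: "nat \<Rightarrow> 'a::zero"
    using that by (elim disjE) (simp_all only: upt list.map of_nat_1 of_nat_numeral vector5_nth)
  show ?thesis
    by (simp only: matrix5_def nth[OF i] nth[OF j])
qed

definition TW_entry_A :: "(nat \<Rightarrow> complex) \<Rightarrow> complex \<Rightarrow> nat \<Rightarrow> nat \<Rightarrow> complex" where
  "TW_entry_A l \<gamma> i j =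
    [[l 1,
      (1 + \<gamma>^2 / (l 2 * l 4)) * (l 2 + \<gamma>^3 / (l 3 * l 4)),
      (1 + l 1 * l 5 / \<gamma>^2) * (l 3 + \<gamma> + \<gamma>^2 / l 3),
      (1 + l 2 * l 4 / \<gamma>^2) * (l 3 + \<gamma>^3 / (l 2 * l 4)),
      \<gamma>^3 / (l 1 * l 5)],
     [0, l 2, l 3 + \<gamma> + \<gamma>^2 / l 3, l 3 + \<gamma> + \<gamma>^3 / (l 1 * l 5), \<gamma>^3 / (l 1 * l 5)],
     [0, 0, l 3, l 3 + \<gamma>^3 / (l 1 * l 5), \<gamma>^3 / (l 1 * l 5)],
     [0, 0, 0, l 4, l 4],
     [0, 0, 0, 0, l 5]] ! (i - 1) ! (j - 1)"

definition TW_A :: "(nat \<Rightarrow> complex) \<Rightarrow> complex \<Rightarrow> complex^5^5" where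
  "TW_A l \<gamma> = matrix5 (TW_entry_A l \<gamma>)"

text \<open>\<open>(-1)\<^sup>i\<^sup>+\<^sup>j\<close> replaces \<open>(-1)\<^sup>i\<^sup>-\<^sup>j\<close> because subtraction on \<open>nat\<close> truncates.\<close>

definition TW_B :: "(nat \<Rightarrow> complex) \<Rightarrow> complex \<Rightarrow> complex^5^5" where
  "TW_B l \<gamma> = matrix5 (\<lambda>i j. (-1) ^ (i + j) * TW_entry_A l \<gamma> (6 - i) (6 - j))"

text \<open>The values on the two generators determine \<open>\<rho>\<close> on the carrier of \<open>B3\<close>.\<close>

definition TW_representation ::
  "(nat \<Rightarrow> complex) \<Rightarrow> complex \<Rightarrow> (braid_gen word set \<Rightarrow> complex^5 \<Rightarrow> complex^5) \<Rightarrow> bool" where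
  "TW_representation l \<gamma> \<rho> \<longleftrightarrow>
     representation B3 (\<lambda>c v. c *s v) \<rho> \<and>
     \<rho> (B3_gen Sigma1) = (\<lambda>v. TW_A l \<gamma> *v v) \<and>
     \<rho> (B3_gen Sigma2) = (\<lambda>v. TW_B l \<gamma> *v v)"

end

theory Submission
  imports Defs "HOL-Computational_Algebra.Fundamental_Theorem_Algebra"
begin

text \<open>A standard extension amounts to a scalar \<open>k\<close> and an involution \<open>s\<close> such that
  \<open>c = k \<rho>(\<sigma>\<^sub>1\<sigma>\<^sub>2)\<close> satisfies \<open>c\<^sup>3 = 1\<close> and \<open>s c s = c\<inverse>\<close>: put \<open>s\<^sub>1 = s\<close>, \<open>s\<^sub>2 = s c\<close>. When
  \<open>\<rho>(\<sigma>\<^sub>1\<sigma>\<^sub>2)\<^sup>3\<close> is a scalar, such an \<open>s\<close> exists as soon as two of the three eigenspaces of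
  \<open>\<rho>(\<sigma>\<^sub>1\<sigma>\<^sub>2)\<close> have equal dimension, since \<open>k\<close> can be chosen so that \<open>s\<close> may swap them. In
  dimension five it therefore suffices that all eigenspaces have dimension at most 2. For the
  Tuba-Wenzl representations this is read off the matrix \<open>A B\<close>, which vanishes above its
  antidiagonal. An irreducible representation is treated without the classification of Tuba and
  Wenzl: by Schur's lemma \<open>\<rho>(\<sigma>\<^sub>1\<sigma>\<^sub>2)\<^sup>3 = \<rho>(\<sigma>\<^sub>1\<sigma>\<^sub>2\<sigma>\<^sub>1)\<^sup>2\<close> is a scalar, so
  \<open>\<rho>(\<sigma>\<^sub>1\<sigma>\<^sub>2\<sigma>\<^sub>1)\<close> has an eigenspace of dimension at least 3. It would meet a three-dimensional
  eigenspace of \<open>\<rho>(\<sigma>\<^sub>1\<sigma>\<^sub>2)\<close> in a common eigenvector, which spans an invariant line.\<close>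

section \<open>Homomorphisms out of presented groups\<close>

definition eval_word :: "('h, 'm) monoid_scheme \<Rightarrow> ('g \<Rightarrow> 'h) \<Rightarrow> 'g word \<Rightarrow> 'h" where
  "eval_word G F u =
     foldr (\<lambda>(g, e) x. (if e then F g else inv\<^bsub>G\<^esub> F g) \<otimes>\<^bsub>G\<^esub> x) u \<one>\<^bsub>G\<^esub>"

lemma eval_word_Nil [simp]: "eval_word G F [] = \<one>\<^bsub>G\<^esub>"
  by (simp add: eval_word_def)

lemma eval_word_Cons [simp]:
  "eval_word G F ((g, e) # u) = (if e then F g else inv\<^bsub>G\<^esub> F g) \<otimes>\<^bsub>G\<^esub> eval_word G F u"
  by (simp add: eval_word_def)

context group
begin

lemma eval_word_closed:
  assumes "\<And>g. F g \<in> carrier G"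
  shows "eval_word G F u \<in> carrier G"
  by (induction u) (auto simp: assms)

lemma eval_word_append:
  assumes "\<And>g. F g \<in> carrier G"
  shows "eval_word G F (u @ v) = eval_word G F u \<otimes> eval_word G F v"
  by (induction u) (auto simp: assms eval_word_closed m_assoc)

text \<open>\<open>pres_cong\<close> is generated by rules that equality of values in a group obeys:
  the relations by hypothesis, cancellation by inverses, and concatenation because evaluation is
  multiplicative.\<close>

lemma eval_word_pres_cong:
  assumes F: "\<And>g. F g \<in> carrier G"
    and R: "\<And>u v. (u, v) \<in> R \<Longrightarrow> eval_word G F u = eval_word G F v"
    and "pres_cong R u v"
  shows "eval_word G F u = eval_word G F v"
  using assms(3) by induction (auto simp: R F eval_word_append)

text \<open>Universal property of a presentation. A class is sent to the value of an arbitrarily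
  chosen word in it; invariance under \<open>pres_cong\<close> makes the choice harmless.\<close>

lemma presented_group_hom_exists:
  assumes F: "\<And>g. F g \<in> carrier G"
    and R: "\<And>u v. (u, v) \<in> R \<Longrightarrow> eval_word G F u = eval_word G F v"
  shows "\<exists>\<phi> \<in> hom (presented_group R) G. \<forall>u. \<phi> (word_class R u) = eval_word G F u"
proof
  define \<phi> where "\<phi> X = eval_word G F (SOME u. X = word_class R u)" for X
  have \<phi>: "\<phi> (word_class R u) = eval_word G F u" for u
  proof -
    have "word_class R u = word_class R (SOME v. word_class R u = word_class R v)"
      by (rule someI) (rule HOL.refl)
    then show ?thesis
      unfolding \<phi>_def using eval_word_pres_cong[of F R, OF F R]
      by (metis word_class_eq_iff)
  qed
  then show "\<forall>u. \<phi> (word_class R u) = eval_word G F u"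
    by blast
  show "\<phi> \<in> hom (presented_group R) G"
  proof (rule homI)
    fix X assume "X \<in> carrier (presented_group R)"
    then show "\<phi> X \<in> carrier G"
      by (auto simp: presented_group_def \<phi> F eval_word_closed)
  next
    fix X Y assume "X \<in> carrier (presented_group R)" "Y \<in> carrier (presented_group R)"
    then obtain u v where "X = word_class R u" "Y = word_class R v"
      by (auto simp: presented_group_def)
    then show "\<phi> (X \<otimes>\<^bsub>presented_group R\<^esub> Y) = \<phi> X \<otimes> \<phi> Y"
      by (simp add: presented_group_mult \<phi> F eval_word_append)
  qed
qed

text \<open>Homomorphisms preserve inverses, so the values on the generators fix the value on every
  letter and hence on every word. This later extends invariance under generators to the whole
  group.\<close>

lemma presented_group_hom_eval_word:
  assumes \<phi>: "\<phi> \<in> hom (presented_group R) G"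
  shows "\<phi> (word_class R u) = eval_word G (\<lambda>g. \<phi> (word_class R (pos [g]))) u"
proof -
  interpret P: group "presented_group R" by (rule group_presented_group)
  interpret \<phi>: group_hom "presented_group R" G \<phi>
    using \<phi> by unfold_locales
  have one: "\<one>\<^bsub>presented_group R\<^esub> = word_class R []" by (simp add: presented_group_def)
  have car: "word_class R v \<in> carrier (presented_group R)" for v
    by (simp add: presented_group_def)
  show ?thesis
  proof (induction u)
    case Nil
    show ?case using \<phi>.hom_one by (simp add: one)
  next
    case (Cons a u)
    obtain g e where a: "a = (g, e)" by (cases a)
    \<comment> \<open>Cancellation taken with first letter \<open>(g, False)\<close> shows that the
      class of the formal inverse is a left inverse of the generator.\<close>
    have "word_class R [(g, False)] = inv\<^bsub>presented_group R\<^esub> (word_class R (pos [g]))"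
      using pres_cong.cancel[of R g False]
      by (intro P.inv_equality[symmetric] car)
        (simp add: presented_group_mult one word_class_eq_iff pos_def)
    then have "\<phi> (word_class R [(g, e)]) =
        (if e then \<phi> (word_class R (pos [g])) else inv \<phi> (word_class R (pos [g])))"
      by (cases e) (simp_all add: car pos_def)
    moreover have "\<phi> (word_class R (a # u)) = \<phi> (word_class R [(g, e)]) \<otimes> \<phi> (word_class R u)"
      using \<phi>.hom_mult[OF car[of "[(g, e)]"] car[of u]] by (simp add: presented_group_mult a)
    ultimately show ?case
      by (simp add: Cons a)
  qed
qed

end

section \<open>The general linear group\<close>

lemma group_GL:
  assumes "vector_space scl"
  shows "group (GL scl)"
proof (rule groupI)
  interpret vector_space scl by (rule assms)
  fix f assume f: "f \<in> carrier (GL scl)"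
  then have lf: "Vector_Spaces.linear scl scl f" and bf: "bij f"
    by (auto simp: GL_def)
  interpret f: Vector_Spaces.linear scl scl f by (rule lf)
  have "Vector_Spaces.linear scl scl (inv_into UNIV f)"
  proof -
    have "inv_into UNIV f (x + y) = inv_into UNIV f x + inv_into UNIV f y" for x y
      by (rule inv_f_eq) (simp_all add: bf bij_is_inj f.add surj_f_inv_f bij_is_surj)
    moreover have "inv_into UNIV f (scl r x) = scl r (inv_into UNIV f x)" for r x
      by (rule inv_f_eq) (simp_all add: bf bij_is_inj f.scale surj_f_inv_f bij_is_surj)
    ultimately show ?thesis
      by unfold_locales
  qed
  then show "\<exists>g\<in>carrier (GL scl). g \<otimes>\<^bsub>GL scl\<^esub> f = \<one>\<^bsub>GL scl\<^esub>"
    using bf by (intro bexI[of _ "inv_into UNIV f"])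
      (auto simp: GL_def bij_is_inj bij_imp_bij_inv)
next
  interpret vector_space scl by (rule assms)
  show "\<one>\<^bsub>GL scl\<^esub> \<in> carrier (GL scl)"
    using linear_id bij_id by (simp add: GL_def id_def)
qed (auto simp: GL_def intro: Vector_Spaces.linear_compose bij_comp)

text \<open>The abstract inverse is a left inverse of a surjective map, so it must be the
  set-theoretic one. This makes formal inverses in words computable.\<close>

lemma inv_GL:
  assumes "vector_space scl" and f: "f \<in> carrier (GL scl)"
  shows "inv\<^bsub>GL scl\<^esub> f = inv_into UNIV f"
proof -
  interpret GL: group "GL scl" by (rule group_GL[OF assms(1)])
  have "bij f" using f by (simp add: GL_def)
  have "inv\<^bsub>GL scl\<^esub> f \<circ> f = id"
    using GL.l_inv[OF f] by (simp add: GL_def)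
  then show ?thesis
    using \<open>bij f\<close> by (metis bij_is_surj comp_assoc comp_id id_comp surj_iff)
qed

section \<open>Representations from generators\<close>

lemma GL_linear_bij:
  assumes "f \<in> carrier (GL scl)"
  shows "Vector_Spaces.linear scl scl f" "bij f"
  using assms by (auto simp: GL_def)

lemma GL_mult: "f \<otimes>\<^bsub>GL scl\<^esub> g = f \<circ> g"
  and GL_one: "\<one>\<^bsub>GL scl\<^esub> = id"
  by (simp_all add: GL_def)

lemma B3_representation_gens:
  assumes "representation B3 scl \<rho>"
  defines "f \<equiv> \<rho> (B3_gen Sigma1)" and "g \<equiv> \<rho> (B3_gen Sigma2)"
  shows "f \<in> carrier (GL scl)" "g \<in> carrier (GL scl)" "f \<circ> g \<circ> f = g \<circ> f \<circ> g"
    and "\<rho> (B3_gen Sigma1 \<otimes>\<^bsub>B3\<^esub> B3_gen Sigma2) = f \<circ> g"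
proof -
  interpret P: group B3 unfolding B3_def by (rule group_presented_group)
  have V: "vector_space scl" and \<rho>: "\<rho> \<in> hom B3 (GL scl)"
    using assms(1) by (auto simp: representation_def)
  have car: "B3_gen a \<in> carrier B3" for a
    by (simp add: B3_gen_def B3_def presented_group_def)
  have mult: "\<rho> (x \<otimes>\<^bsub>B3\<^esub> y) = \<rho> x \<circ> \<rho> y" if "x \<in> carrier B3" "y \<in> carrier B3" for x y
    using hom_mult[OF \<rho> that] by (simp add: GL_def)
  show "f \<in> carrier (GL scl)" "g \<in> carrier (GL scl)"
    unfolding f_def g_def using hom_in_carrier[OF \<rho> car] by auto
  show "\<rho> (B3_gen Sigma1 \<otimes>\<^bsub>B3\<^esub> B3_gen Sigma2) = f \<circ> g"
    by (simp add: mult car f_def g_def)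
  have "B3_gen Sigma1 \<otimes>\<^bsub>B3\<^esub> B3_gen Sigma2 \<otimes>\<^bsub>B3\<^esub> B3_gen Sigma1 =
      B3_gen Sigma2 \<otimes>\<^bsub>B3\<^esub> B3_gen Sigma1 \<otimes>\<^bsub>B3\<^esub> B3_gen Sigma2"
    unfolding B3_gen_def B3_def
    by (auto simp: presented_group_mult word_class_eq_iff pos_def B3_relations_def intro!: pres_cong.rel)
  then have "\<rho> (B3_gen Sigma1 \<otimes>\<^bsub>B3\<^esub> B3_gen Sigma2 \<otimes>\<^bsub>B3\<^esub> B3_gen Sigma1) =
      \<rho> (B3_gen Sigma2 \<otimes>\<^bsub>B3\<^esub> B3_gen Sigma1 \<otimes>\<^bsub>B3\<^esub> B3_gen Sigma2)"
    by (rule arg_cong)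
  then show "f \<circ> g \<circ> f = g \<circ> f \<circ> g"
    by (simp add: mult car f_def g_def)
qed

lemma B3_representation_exists:
  assumes V: "vector_space scl"
    and f: "f \<in> carrier (GL scl)" and g: "g \<in> carrier (GL scl)"
    and braid: "f \<circ> g \<circ> f = g \<circ> f \<circ> g"
  shows "\<exists>\<rho>. representation B3 scl \<rho> \<and> \<rho> (B3_gen Sigma1) = f \<and> \<rho> (B3_gen Sigma2) = g"
proof -
  interpret GL: group "GL scl" by (rule group_GL[OF V])
  let ?F = "\<lambda>a. case a of Sigma1 \<Rightarrow> f | Sigma2 \<Rightarrow> g"
  have F: "?F a \<in> carrier (GL scl)" for a
    using f g by (cases a) auto
  have R: "eval_word (GL scl) ?F u = eval_word (GL scl) ?F v" if "(u, v) \<in> B3_relations" for u v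
    using that unfolding B3_relations_def pos_def
    by (elim insertE emptyE) (simp_all add: GL_mult GL_one braid[unfolded comp_assoc])
  obtain \<rho> where "\<rho> \<in> hom (presented_group B3_relations) (GL scl)"
    "\<And>u. \<rho> (word_class B3_relations u) = eval_word (GL scl) ?F u"
    using GL.presented_group_hom_exists[of ?F, OF F R] by blast
  then have "representation B3 scl \<rho> \<and> \<rho> (B3_gen Sigma1) = f \<and> \<rho> (B3_gen Sigma2) = g"
    using V f g by (auto simp: GL.r_one representation_def B3_def B3_gen_def pos_def)
  then show ?thesis by blast
qed

lemma LB3_representation_exists:
  assumes V: "vector_space scl"
    and car: "f \<in> carrier (GL scl)" "g \<in> carrier (GL scl)" "s \<in> carrier (GL scl)" "t \<in> carrier (GL scl)"
    and rels: "f \<circ> g \<circ> f = g \<circ> f \<circ> g" "s \<circ> t \<circ> s = t \<circ> s \<circ> t" "s \<circ> s = id" "t \<circ> t = id"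
      "s \<circ> t \<circ> f = g \<circ> s \<circ> t" "f \<circ> g \<circ> s = t \<circ> f \<circ> g"
  shows "\<exists>\<rho>. representation LB3 scl \<rho> \<and> \<rho> (LB3_gen LSigma1) = f \<and> \<rho> (LB3_gen LSigma2) = g \<and>
    \<rho> (LB3_gen S1 \<otimes>\<^bsub>LB3\<^esub> LB3_gen S2) = s \<circ> t"
proof -
  interpret GL: group "GL scl" by (rule group_GL[OF V])
  let ?F = "\<lambda>a. case a of LSigma1 \<Rightarrow> f | LSigma2 \<Rightarrow> g | S1 \<Rightarrow> s | S2 \<Rightarrow> t"
  have F: "?F a \<in> carrier (GL scl)" for a
    using car by (cases a) auto
  have R: "eval_word (GL scl) ?F u = eval_word (GL scl) ?F v" if "(u, v) \<in> LB3_relations" for u v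
    using that unfolding LB3_relations_def pos_def
    by (elim insertE emptyE) (simp_all add: GL_mult GL_one rels[unfolded comp_assoc])
  obtain \<rho> where "\<rho> \<in> hom (presented_group LB3_relations) (GL scl)"
    "\<And>u. \<rho> (word_class LB3_relations u) = eval_word (GL scl) ?F u"
    using GL.presented_group_hom_exists[of ?F, OF F R] by blast
  then have "representation LB3 scl \<rho> \<and> \<rho> (LB3_gen LSigma1) = f \<and> \<rho> (LB3_gen LSigma2) = g \<and>
    \<rho> (LB3_gen S1 \<otimes>\<^bsub>LB3\<^esub> LB3_gen S2) = s \<circ> t"
    using V car by (auto simp: representation_def LB3_def LB3_gen_def pos_def presented_group_mult GL_mult GL_one)
  then show ?thesis by blast
qed

text \<open>Put \<open>t = s \<circ> c\<close>, so that \<open>s \<circ> t = c\<close>. Then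
  \<open>t\<close> is an involution because \<open>c s c = s\<close>, and the braid relation for
  \<open>s\<close>, \<open>t\<close> becomes \<open>c s = s c c\<close>, which follows from
  \<open>c s c = s\<close> and \<open>c c c = id\<close>.\<close>

lemma standard_extensionI:
  assumes \<rho>: "representation B3 scl \<rho>"
    and c: "\<And>v. c v = scl k (\<rho> (B3_gen Sigma1) (\<rho> (B3_gen Sigma2) v))"
    and k: "k \<noteq> 0"
    and s: "s \<in> carrier (GL scl)" "s \<circ> s = id"
    and ccc: "c \<circ> c \<circ> c = id" and csc: "c \<circ> s \<circ> c = s"
  shows "admits_standard_extension scl \<rho>"
proof -
  define f where "f = \<rho> (B3_gen Sigma1)"
  define g where "g = \<rho> (B3_gen Sigma2)"
  note gens = B3_representation_gens[OF \<rho>, folded f_def g_def]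
  have V: "vector_space scl"
    using \<rho> by (simp add: representation_def)
  interpret V: vector_space scl by (rule V)
  interpret GL: group "GL scl" by (rule group_GL[OF V])
  interpret f: Vector_Spaces.linear scl scl f by (rule GL_linear_bij[OF gens(1)])
  interpret g: Vector_Spaces.linear scl scl g by (rule GL_linear_bij[OF gens(2)])
  have c': "c v = scl k (f (g v))" for v
    by (simp add: c f_def g_def)
  interpret c: Vector_Spaces.linear scl scl c
    by unfold_locales (simp_all add: c' f.add g.add f.scale g.scale V.scale_right_distrib mult.commute)
  have "bij c"
    by (rule o_bij[of "c \<circ> c"]) (simp_all add: ccc comp_assoc[symmetric])
  then have "c \<in> carrier (GL scl)"
    using c.linear_axioms by (simp add: GL_def)
  then have sc: "s \<circ> c \<in> carrier (GL scl)"
    using GL.m_closed[OF s(1), of c] by (simp add: GL_def)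
  interpret s: Vector_Spaces.linear scl scl s by (rule GL_linear_bij[OF s(1)])
  have braid: "f (g (f v)) = g (f (g v))" for v
    using fun_cong[OF gens(3), of v] by simp
  have ss: "s (s v) = v" and c3: "c (c (c v)) = v" and csc': "c (s (c v)) = s v" for v
    using fun_cong[OF s(2), of v] fun_cong[OF ccc, of v] fun_cong[OF csc, of v] by simp_all
  have cs: "c (s v) = s (c (c v))" for v
    by (metis csc' c3)
  have fg: "f (g v) = scl (inverse k) (c v)" for v
    by (simp add: c' k)
  have "\<exists>\<rho>'. representation LB3 scl \<rho>' \<and> \<rho>' (LB3_gen LSigma1) = f \<and> \<rho>' (LB3_gen LSigma2) = g \<and>
      \<rho>' (LB3_gen S1 \<otimes>\<^bsub>LB3\<^esub> LB3_gen S2) = s \<circ> (s \<circ> c)"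
  proof (rule LB3_representation_exists[OF V gens(1,2) s(1) sc gens(3) _ s(2)])
    \<comment> \<open>Since \<open>s \<circ> t = c\<close>, this says \<open>c f = g c\<close>: the
      braid relation of \<open>f\<close> and \<open>g\<close>, multiplied by
      \<open>k\<close>.\<close>
    show "s \<circ> (s \<circ> c) \<circ> f = g \<circ> s \<circ> (s \<circ> c)"
      by (simp add: fun_eq_iff ss c' g.scale braid)
    \<comment> \<open>With \<open>f g = c / k\<close> this is again \<open>c s = s c c\<close>,
      divided by \<open>k\<close>.\<close>
    show "f \<circ> g \<circ> s = s \<circ> c \<circ> f \<circ> g"
    proof
      fix v
      have "(f \<circ> g \<circ> s) v = scl (inverse k) (c (s v))" by (simp add: fg)
      also have "\<dots> = s (c (scl (inverse k) (c v)))"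
        by (simp add: cs s.scale c.scale)
      finally show "(f \<circ> g \<circ> s) v = (s \<circ> c \<circ> f \<circ> g) v" by (simp add: fg)
    qed
  qed (simp_all add: fun_eq_iff ss cs csc' c3)
  then obtain \<rho>' where \<rho>': "representation LB3 scl \<rho>'" "\<rho>' (LB3_gen LSigma1) = f"
    "\<rho>' (LB3_gen LSigma2) = g" "\<rho>' (LB3_gen S1 \<otimes>\<^bsub>LB3\<^esub> LB3_gen S2) = s \<circ> (s \<circ> c)"
    by blast
  moreover have "s \<circ> (s \<circ> c) = (\<lambda>v. scl k (\<rho> (B3_gen Sigma1 \<otimes>\<^bsub>B3\<^esub> B3_gen Sigma2) v))"
    by (simp add: gens(4) fun_eq_iff ss c')
  ultimately show ?thesis
    unfolding admits_standard_extension_def is_standard_extension_def is_extension_def f_def g_def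
    by metis
qed

section \<open>Standard extensions from eigenspace dimensions\<close>

definition eigenspace :: "(complex \<Rightarrow> 'v::ab_group_add \<Rightarrow> 'v) \<Rightarrow> ('v \<Rightarrow> 'v) \<Rightarrow> complex \<Rightarrow> 'v set" where
  "eigenspace scl f z = {v. f v = scl z v}"

lemma subspace_eigenspace:
  assumes "Vector_Spaces.linear scl scl f"
  shows "module.subspace scl (eigenspace scl f z)"
proof -
  interpret f: Vector_Spaces.linear scl scl f by (rule assms)
  show ?thesis
    by (intro f.vs1.subspaceI)
      (simp_all add: eigenspace_def f.add f.scale f.vs1.scale_right_distrib mult.commute)
qed

text \<open>An infinite basis has \<open>card\<close> 0, so a positive \<open>dim\<close> forces a
  finite one. This turns the numerical hypothesis on the dimension into the finite-dimensional
  locale.\<close>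

lemma finite_dimensional_if_dim_pos:
  assumes "vector_space scl" "vector_space.dim scl (UNIV :: 'v::ab_group_add set) > 0"
  shows "\<exists>B :: 'v set. finite_dimensional_vector_space scl B"
proof -
  interpret vector_space scl by (rule assms(1))
  obtain B where B: "B \<subseteq> UNIV" "independent B" "UNIV \<subseteq> span B" "card B = dim UNIV"
    by (rule basis_exists)
  then have "finite B"
    using assms(2) by (intro card_ge_0_finite) simp
  then have "finite_dimensional_vector_space scl B"
    using B by unfold_locales auto
  then show ?thesis by blast
qed

section \<open>Linear maps of order three\<close>

lemma primitive_cube_root_exists:
  obtains w e :: complex where "1 + w + e = 0" "w * w = e" "e * e = w" "w * e = 1"
proof -
  define w where "w = Complex (- 1 / 2) (sqrt 3 / 2)"
  define e where "e = Complex (- 1 / 2) (- sqrt 3 / 2)"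
  have "1 + w + e = 0" "w * w = e" "e * e = w" "w * e = 1"
    by (simp_all add: complex_eq_iff w_def e_def field_simps)
  then show ?thesis by (rule that)
qed

text \<open>The numbers 1, \<open>w\<close>, \<open>e\<close> are the three cube roots of unity,
  hence the only possible eigenvalues of \<open>c\<close>.\<close>

locale order_three_map = Vector_Spaces.linear scl scl c
  for scl :: "complex \<Rightarrow> 'v::ab_group_add \<Rightarrow> 'v" and c +
  fixes w e :: complex
  assumes ccc: "c (c (c v)) = v"
    and roots: "1 + w + e = 0" "w * w = e" "e * e = w" "w * e = 1"
begin

text \<open>The action of the element \<open>p + q c + r c\<^sup>2\<close> of the group algebra of
  the cyclic group of order three; applying \<open>c\<close> rotates the coefficients.\<close>

definition comb :: "complex \<Rightarrow> complex \<Rightarrow> complex \<Rightarrow> 'v \<Rightarrow> 'v" where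
  "comb p q r v = scl p v + scl q (c v) + scl r (c (c v))"

lemma comb_add: "comb p q r v + comb p' q' r' v = comb (p + p') (q + q') (r + r') v"
  by (simp add: comb_def vs1.scale_left_distrib)

lemma comb_scale: "scl a (comb p q r v) = comb (a * p) (a * q) (a * r) v"
  by (simp add: comb_def vs1.scale_right_distrib)

lemma c_comb: "c (comb p q r v) = comb r p q v"
  by (simp add: comb_def add scale ccc)

lemma linear_comb: "Vector_Spaces.linear scl scl (comb p q r)"
  by unfold_locales (simp_all add: comb_def add scale vs1.scale_right_distrib mult.commute)

lemma comb_eigenspace:
  assumes "v \<in> eigenspace scl c z"
  shows "comb p q r v = scl (p + q * z + r * z * z) v"
  using assms by (simp add: comb_def eigenspace_def scale vs1.scale_left_distrib mult.assoc)

lemma decomposition: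
  obtains x y z where "x \<in> eigenspace scl c 1" "y \<in> eigenspace scl c w" "z \<in> eigenspace scl c e"
    "v = x + y + z"
proof
  have "w * e / 3 = 1 / 3" "e * w = 1"
    using roots by (simp_all add: mult.commute)
  \<comment> \<open>The spectral projection for an eigenvalue \<open>z\<close> is
    \<open>(1 + c / z + c\<^sup>2 / z\<^sup>2) / 3\<close>, where \<open>1 / w = e\<close> and
    \<open>1 / e = w\<close>. The three projections add up to the identity.\<close>
  then show "comb (1/3) (1/3) (1/3) v \<in> eigenspace scl c 1" "comb (1/3) (e/3) (w/3) v \<in> eigenspace scl c w"
    "comb (1/3) (w/3) (e/3) v \<in> eigenspace scl c e"
    using roots by (simp_all add: eigenspace_def c_comb comb_scale)
  have "1/3 + e/3 + w/3 = (1 + w + e)/3" "1/3 + w/3 + e/3 = (1 + w + e)/3"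
    by (simp_all add: field_simps)
  then have "comb (1/3) (1/3) (1/3) v + comb (1/3) (e/3) (w/3) v + comb (1/3) (w/3) (e/3) v = comb 1 0 0 v"
    using roots by (simp add: comb_add)
  then show "v = comb (1/3) (1/3) (1/3) v + comb (1/3) (e/3) (w/3) v + comb (1/3) (w/3) (e/3) v"
    by (simp add: comb_def)
qed

lemma subspace_eigenspace_c: "vs1.subspace (eigenspace scl c z)"
  by (rule subspace_eigenspace) (rule linear_axioms)

text \<open>By \<open>decomposition\<close> the eigenspaces together span the space, and the
  dimension formula for sums is applied twice.\<close>

lemma dim_UNIV_le:
  assumes "finite_dimensional_vector_space scl B"
  shows "vs1.dim UNIV \<le>
    vs1.dim (eigenspace scl c 1) + vs1.dim (eigenspace scl c w) + vs1.dim (eigenspace scl c e)"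
proof -
  interpret fd: finite_dimensional_vector_space scl B by (rule assms)
  let ?E = "eigenspace scl c"
  let ?S = "{x + y |x y. x \<in> ?E 1 \<and> y \<in> ?E w}"
  have "v \<in> {x + y |x y. x \<in> ?S \<and> y \<in> ?E e}" for v
  proof -
    obtain x y z where v: "x \<in> ?E 1" "y \<in> ?E w" "z \<in> ?E e" "v = x + y + z"
      by (rule decomposition)
    then have "x + y \<in> ?S" by blast
    with v show ?thesis by blast
  qed
  then have "UNIV = {x + y |x y. x \<in> ?S \<and> y \<in> ?E e}"
    by blast
  then have "vs1.dim UNIV \<le> vs1.dim ?S + vs1.dim (?E e)"
    using fd.dim_sums_Int[OF vs1.subspace_sums, of "?E 1" "?E w" "?E e"] subspace_eigenspace_c
    by simp
  moreover have "vs1.dim ?S \<le> vs1.dim (?E 1) + vs1.dim (?E w)"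
    using fd.dim_sums_Int[of "?E 1" "?E w"] subspace_eigenspace_c by simp
  ultimately show ?thesis by linarith
qed

text \<open>The identity on the eigenspace of 1 together with a swap of the two other eigenspaces
  conjugates \<open>c\<close> into its inverse.\<close>

lemma inverting_involution_exists:
  assumes "finite_dimensional_vector_space scl B"
    and dims: "vs1.dim (eigenspace scl c w) = vs1.dim (eigenspace scl c e)"
  shows "\<exists>s \<in> carrier (GL scl). s \<circ> s = id \<and> c \<circ> s \<circ> c = s"
proof -
  interpret fd: finite_dimensional_vector_space scl B by (rule assms)
  interpret fp: finite_dimensional_vector_space_pair scl B scl B ..
  let ?E = "eigenspace scl c"
  obtain p where p: "Vector_Spaces.linear scl scl p" "p ` ?E w = ?E e" "inj_on p (?E w)"
    using fp.subspace_isomorphism[OF subspace_eigenspace_c subspace_eigenspace_c dims] by blast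
  obtain q where q: "Vector_Spaces.linear scl scl q" "\<And>v. v \<in> ?E w \<Longrightarrow> q (p v) = v"
    using fp.linear_exists_left_inverse_on[OF p(1) subspace_eigenspace_c p(3)] by blast
  have pq: "p y \<in> ?E e" if "y \<in> ?E w" for y
    using p(2) that by blast
  have qp: "q y \<in> ?E w \<and> p (q y) = y" if "y \<in> ?E e" for y
    using p(2) q(2) that by force
  \<comment> \<open>The three combinations are the projections to the eigenspaces of 1,
    \<open>w\<close> and \<open>e\<close>; \<open>p\<close> carries the second eigenspace onto the
    third, and \<open>q\<close> carries it back.\<close>
  define s where "s = (\<lambda>v. comb (1/3) (1/3) (1/3) v + p (comb (1/3) (e/3) (w/3) v) + q (comb (1/3) (w/3) (e/3) v))"
  interpret p: Vector_Spaces.linear scl scl p by (rule p(1))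
  interpret q: Vector_Spaces.linear scl scl q by (rule q(1))
  interpret P1: Vector_Spaces.linear scl scl "comb (1/3) (1/3) (1/3)" by (rule linear_comb)
  interpret P2: Vector_Spaces.linear scl scl "comb (1/3) (e/3) (w/3)" by (rule linear_comb)
  interpret P3: Vector_Spaces.linear scl scl "comb (1/3) (w/3) (e/3)" by (rule linear_comb)
  interpret s: Vector_Spaces.linear scl scl s
    by unfold_locales
      (simp_all add: s_def p.add q.add p.scale q.scale P1.add P2.add P3.add P1.scale P2.scale P3.scale
        vs1.scale_right_distrib)
  have z: "1/3 + e/3 + w/3 = 0" "1/3 + w/3 + e/3 = 0" "e * w = 1"
    using roots by (simp_all add: mult.commute add_divide_distrib[symmetric] add.commute add.left_commute)
  have s1: "s x = x" if "x \<in> ?E 1" for x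
    using that z by (simp add: s_def comb_eigenspace p.zero q.zero)
  have sw: "s y = p y" if "y \<in> ?E w" for y
    using that z roots by (simp add: s_def comb_eigenspace p.zero q.zero)
  have se: "s y = q y" if "y \<in> ?E e" for y
    using that z roots by (simp add: s_def comb_eigenspace p.zero q.zero)
  have ss: "s (s v) = v" for v
  proof -
    obtain x y u where v: "x \<in> ?E 1" "y \<in> ?E w" "u \<in> ?E e" "v = x + y + u"
      by (rule decomposition)
    then show ?thesis
      using pq[OF v(2)] qp[OF v(3)] by (simp add: s.add s1 sw se q(2) p.add q.add ac_simps)
  qed
  have "c (s (c v)) = s v" for v
  proof -
    obtain x y u where v: "x \<in> ?E 1" "y \<in> ?E w" "u \<in> ?E e" "v = x + y + u"
      by (rule decomposition)
    then have cv: "c x = x" "c y = scl w y" "c u = scl e u"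
      by (simp_all add: eigenspace_def)
    \<comment> \<open>On the eigenspace of \<open>w\<close>, \<open>c s c\<close> multiplies
      \<open>s\<close> by \<open>w\<close> on the right and \<open>e\<close> on the left, and
      \<open>w * e = 1\<close>; likewise with \<open>w\<close> and \<open>e\<close>
      exchanged.\<close>
    have "c (p y) = scl e (p y)" "c (q u) = scl w (q u)"
      using pq[OF v(2)] qp[OF v(3)] by (auto simp: eigenspace_def)
    then show ?thesis
      using v z roots by (simp add: add s.add scale s.scale s1 sw se cv)
  qed
  then have "c \<circ> s \<circ> c = s"
    by (simp add: fun_eq_iff)
  moreover have "s \<circ> s = id"
    by (simp add: fun_eq_iff ss)
  moreover from this have "s \<in> carrier (GL scl)"
    using s.linear_axioms by (simp add: GL_def o_bij)
  ultimately show ?thesis by blast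
qed

end

text \<open>After rescaling \<open>h\<close> to order three, its three eigenspace dimensions are at
  most 2 and sum to at least 5, so two of them coincide.\<close>

lemma standard_extension_if_eigenspaces_small:
  assumes \<rho>: "representation B3 scl \<rho>" and dim: "vector_space.dim scl (UNIV :: 'v::ab_group_add set) = 5"
  defines "h \<equiv> \<lambda>v :: 'v. \<rho> (B3_gen Sigma1) (\<rho> (B3_gen Sigma2) v)"
  assumes hhh: "\<And>v. h (h (h v)) = scl d v"
    and small: "\<And>z. vector_space.dim scl (eigenspace scl h z) \<le> 2"
  shows "admits_standard_extension scl \<rho>"
proof -
  note gens = B3_representation_gens[OF \<rho>]
  have V: "vector_space scl"
    using \<rho> by (simp add: representation_def)
  obtain B where fin: "finite_dimensional_vector_space scl (B :: 'v set)"
    using finite_dimensional_if_dim_pos[OF V] dim by auto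
  interpret fd: finite_dimensional_vector_space scl B by (rule fin)
  interpret f: Vector_Spaces.linear scl scl "\<rho> (B3_gen Sigma1)" by (rule GL_linear_bij[OF gens(1)])
  interpret g: Vector_Spaces.linear scl scl "\<rho> (B3_gen Sigma2)" by (rule GL_linear_bij[OF gens(2)])
  interpret h: Vector_Spaces.linear scl scl h
    by unfold_locales (simp_all add: h_def f.add g.add f.scale g.scale)
  have "bij h"
    using bij_comp[OF GL_linear_bij(2)[OF gens(2)] GL_linear_bij(2)[OF gens(1)]] by (simp add: h_def comp_def)
  have "d \<noteq> 0"
  proof
    \<comment> \<open>Then the injective map \<open>h\<close> would have cube zero, which leaves
      only the zero space.\<close>
    assume "d = 0"
    have "v = 0" for v :: 'v
    proof -
      have "h (h (h v)) = h (h (h 0))"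
        using \<open>d = 0\<close> by (simp only: hhh fd.scale_zero_left)
      then show ?thesis
        by (simp only: inj_eq[OF bij_is_inj[OF \<open>bij h\<close>]])
    qed
    then have "(UNIV :: 'v set) = {0}"
      by auto
    then have "fd.dim (UNIV :: 'v set) = fd.dim {0 :: 'v}"
      by (rule arg_cong)
    then show False
      using dim by (simp only: fd.dim_singleton) simp
  qed
  obtain w e :: complex where roots: "1 + w + e = 0" "w * w = e" "e * e = w" "w * e = 1"
    by (rule primitive_cube_root_exists)
  have "\<exists>k. k ^ 3 = inverse d"
    by (rule nth_root_exists) simp
  then obtain k where k: "k ^ 3 = inverse d"
    by blast
  let ?E = "\<lambda>k. eigenspace scl (\<lambda>v. scl k (h v))"
  have E: "?E k z = eigenspace scl h (z / k)" if "k \<noteq> 0" for k z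
  proof -
    have "scl k u = scl z v \<longleftrightarrow> u = scl (z / k) v" for u v
    proof
      assume "scl k u = scl z v"
      then have "scl (inverse k) (scl k u) = scl (inverse k) (scl z v)" by simp
      then show "u = scl (z / k) v" using that by (simp add: divide_inverse mult.commute)
    qed (use that in simp)
    then show ?thesis by (simp add: eigenspace_def)
  qed
  have three: "order_three_map scl (\<lambda>v. scl k (h v)) w e" if k: "k ^ 3 = inverse d" for k
  proof unfold_locales
    fix v
    have "scl k (h (scl k (h (scl k (h v))))) = scl (k ^ 3 * d) v"
      by (simp add: h.scale hhh power3_eq_cube mult.assoc)
    then show "scl k (h (scl k (h (scl k (h v))))) = v"
      using \<open>d \<noteq> 0\<close> by (simp add: k)
  qed (simp_all add: roots h.add h.scale fd.scale_right_distrib fd.scale_left_commute[of k])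
  have "e * w = 1"
    using roots(4) by (subst mult.commute)
  have "w ^ 3 = 1" "e ^ 3 = 1"
    using roots \<open>e * w = 1\<close> by (simp_all add: power3_eq_cube)
  have "k \<noteq> 0"
    using k \<open>d \<noteq> 0\<close> by (intro notI) simp
  have "w \<noteq> 0" "e \<noteq> 0"
    using roots(4) by (intro notI; simp)+
  let ?D = "\<lambda>z. fd.dim (eigenspace scl h z)"
  have "5 \<le> ?D (1 / k) + ?D (w / k) + ?D (e / k)"
    using order_three_map.dim_UNIV_le[OF three[OF k] fin] dim by (simp add: E \<open>k \<noteq> 0\<close>)
  moreover have "?D (1 / k) \<le> 2" "?D (w / k) \<le> 2" "?D (e / k) \<le> 2"
    by (rule small)+
  ultimately consider "?D (w / k) = ?D (e / k)" | "?D (e / k) = ?D (1 / k)" | "?D (1 / k) = ?D (w / k)"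
    by linarith
  \<comment> \<open>Multiplying \<open>k\<close> by \<open>w\<close> or \<open>e\<close> keeps its
    cube and permutes \<open>1 / k\<close>, \<open>w / k\<close>, \<open>e / k\<close> cyclically,
    so the equal pair can be moved to the positions of \<open>w\<close> and
    \<open>e\<close>.\<close>
  then have "\<exists>k. k ^ 3 = inverse d \<and> k \<noteq> 0 \<and> ?D (w / k) = ?D (e / k)"
  proof cases
    case 1
    then show ?thesis using k \<open>k \<noteq> 0\<close> by blast
  next
    case 2
    have "w / (k * e) = e / k" "e / (k * e) = 1 / k"
      using \<open>k \<noteq> 0\<close> \<open>e \<noteq> 0\<close> by (simp_all add: divide_simps roots)
    then show ?thesis
      using 2 k \<open>k \<noteq> 0\<close> \<open>e \<noteq> 0\<close> \<open>e ^ 3 = 1\<close>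
      by (intro exI[of _ "k * e"]) (simp add: power_mult_distrib)
  next
    case 3
    have "w / (k * w) = 1 / k" "e / (k * w) = w / k"
      using \<open>k \<noteq> 0\<close> \<open>w \<noteq> 0\<close> by (simp_all add: divide_simps roots)
    then show ?thesis
      using 3 k \<open>k \<noteq> 0\<close> \<open>w \<noteq> 0\<close> \<open>w ^ 3 = 1\<close>
      by (intro exI[of _ "k * w"]) (simp add: power_mult_distrib)
  qed
  then obtain k where k: "k ^ 3 = inverse d" "k \<noteq> 0" "?D (w / k) = ?D (e / k)"
    by blast
  interpret c: order_three_map scl "\<lambda>v. scl k (h v)" w e
    by (rule three[OF k(1)])
  obtain s where s: "s \<in> carrier (GL scl)" "s \<circ> s = id"
    "(\<lambda>v. scl k (h v)) \<circ> s \<circ> (\<lambda>v. scl k (h v)) = s"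
    using c.inverting_involution_exists[OF fin] k by (auto simp: E)
  show ?thesis
  proof (rule standard_extensionI[OF \<rho> _ k(2) s(1,2) _ s(3)])
    show "scl k (h v) = scl k (\<rho> (B3_gen Sigma1) (\<rho> (B3_gen Sigma2) v))" for v
      by (simp only: h_def)
    show "(\<lambda>v. scl k (h v)) \<circ> (\<lambda>v. scl k (h v)) \<circ> (\<lambda>v. scl k (h v)) = id"
      using c.ccc by (simp only: fun_eq_iff comp_apply id_apply) blast
  qed
qed

section \<open>The five-dimensional Tuba-Wenzl representations\<close>

lemma atLeastAtMost_1_5: "{1..5} = {1, 2, 3, 4, 5 :: nat}"
  by (auto simp: atLeastAtMost_iff)

lemma matrix5_eqI:
  assumes "\<And>i j. i \<in> {1..5} \<Longrightarrow> j \<in> {1..5} \<Longrightarrow> a i j = b i j"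
  shows "matrix5 a = matrix5 b"
proof -
  have "map (\<lambda>j. a i j) [1..<6] = map (\<lambda>j. b i j) [1..<6]" if "i \<in> {1..5}" for i
    using that assms by auto
  then show ?thesis
    unfolding matrix5_def by (intro arg_cong[where f = vector]) (auto intro!: arg_cong[where f = vector])
qed

lemma exhaust_5:
  fixes x :: 5
  shows "x = 1 \<or> x = 2 \<or> x = 3 \<or> x = 4 \<or> x = 5"
proof (induct x)
  case (of_int z)
  then have "0 \<le> z" "z < 5"
    by simp_all
  \<comment> \<open>The residue 0 is the index 5.\<close>
  then have "z = 0 \<or> z = 1 \<or> z = 2 \<or> z = 3 \<or> z = 4"
    by arith
  then show ?case
    by auto
qed

lemma forall_5: "(\<forall>i :: 5. P i) \<longleftrightarrow> P 1 \<and> P 2 \<and> P 3 \<and> P 4 \<and> P 5"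
  by (metis exhaust_5)

lemma UNIV_5: "UNIV = {1, 2, 3, 4, 5 :: 5}"
  using exhaust_5 by auto

lemma sum_5_of_nat: "sum f (UNIV :: 5 set) = (\<Sum>k\<in>{1..5}. f (of_nat k))"
  unfolding atLeastAtMost_1_5 UNIV_5 by (simp add: add.assoc)

lemma vec5_eqI:
  fixes X Y :: "'a^5^5"
  assumes entry: "\<And>i j. i \<in> {1..5} \<Longrightarrow> j \<in> {1..5} \<Longrightarrow> X $ of_nat i $ of_nat j = Y $ of_nat i $ of_nat j"
  shows "X = Y"
proof -
  have index: "\<exists>i \<in> {1..5}. x = of_nat i" for x :: 5
    unfolding atLeastAtMost_1_5 using exhaust_5[of x] by auto
  have "X $ x $ y = Y $ x $ y" for x y
  proof -
    obtain i j where "i \<in> {1..5}" "x = of_nat i" "j \<in> {1..5}" "y = of_nat j"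
      using index[of x] index[of y] by (elim bexE)
    then show ?thesis
      by (simp only: entry)
  qed
  then show ?thesis
    by (simp add: vec_eq_iff)
qed

text \<open>Moves matrix products to natural number indices, where parities and \<open>6 - i\<close>
  make sense.\<close>

lemma matrix5_mult:
  "matrix5 a ** matrix5 b = matrix5 (\<lambda>i j. \<Sum>k\<in>{1..5}. a i k * b k j)"
proof -
  have "(matrix5 a ** matrix5 b) $ of_nat i $ of_nat j =
      matrix5 (\<lambda>i j. \<Sum>k\<in>{1..5}. a i k * b k j) $ of_nat i $ of_nat j"
    if "i \<in> {1..5}" "j \<in> {1..5}" for i j
    using that by (simp add: matrix_matrix_mult_def sum_5_of_nat matrix5_nth del: atLeastAtMost_iff)
  then show ?thesis
    by (rule vec5_eqI)
qed

text \<open>The product \<open>A B\<close> with \<open>l 5\<close> eliminated, so that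
  \<open>u\<close> is \<open>\<gamma>^3 / l 5\<close>. It vanishes above the antidiagonal because it
  equals \<open>(A B A) A\<inverse>\<close>, an antidiagonal matrix times an upper triangular
  one.\<close>

definition TW_entry_AB :: "(nat \<Rightarrow> complex) \<Rightarrow> complex \<Rightarrow> nat \<Rightarrow> nat \<Rightarrow> complex" where
  "TW_entry_AB l \<gamma> i j =
    (let u = l 1 * l 2 * l 3 * l 4 / \<gamma>^2;
         p = (1 + \<gamma>^2 / (l 2 * l 4)) * (1 + \<gamma>^3 / (l 2 * l 3 * l 4));
         q = 1 + \<gamma> / l 3 + \<gamma>^2 / (l 3)^2
     in [[0, 0, 0, 0, u],
         [0, 0, 0, - (\<gamma>^3 / l 4), u],
         [0, 0, \<gamma>^3 / l 3, - (l 2 * \<gamma> + \<gamma>^3 / l 4), u],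
         [0, - (\<gamma>^3 / l 2), \<gamma>^3 / l 2 * q, - (\<gamma>^2 + \<gamma>^3 / l 3 + \<gamma>^5 / (l 2 * l 3 * l 4)), l 1 * l 4],
         [\<gamma>^3 / l 1, - (\<gamma>^3 / l 1 * p), \<gamma>^5 / (l 1 * l 2 * l 4) * q * (1 + \<gamma>^3 / (l 2 * l 3 * l 4)),
          - (\<gamma>^5 / (l 1 * l 3 * l 4) * p), \<gamma>^5 / (l 2 * l 3 * l 4)]] ! (i - 1) ! (j - 1))"

definition TW_AB :: "(nat \<Rightarrow> complex) \<Rightarrow> complex \<Rightarrow> complex^5^5" where
  "TW_AB l \<gamma> = matrix5 (TW_entry_AB l \<gamma>)"

text \<open>The image of the half twist
  \<open>\<sigma>\<^sub>1\<sigma>\<^sub>2\<sigma>\<^sub>1\<close>: a signed flip of the coordinates,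
  scaled by \<open>\<gamma>^3\<close>.\<close>

definition TW_ABA :: "complex \<Rightarrow> complex^5^5" where
  "TW_ABA \<gamma> = matrix5 (\<lambda>i j. if i + j = 6 then (-1) ^ (i + 1) * \<gamma>^3 else 0)"

locale TW_parameters =
  fixes l :: "nat \<Rightarrow> complex" and \<gamma> :: complex
  assumes nz: "\<And>i. i \<in> {1..5} \<Longrightarrow> l i \<noteq> 0"
    and \<gamma>5: "\<gamma> ^ 5 = (\<Prod>i=1..5. l i)"
begin

text \<open>\<open>l (Suc 0)\<close> is the form in which the simplifier leaves
  \<open>l 1\<close>.\<close>

lemma nonzero: "l (Suc 0) \<noteq> 0" "l 2 \<noteq> 0" "l 3 \<noteq> 0" "l 4 \<noteq> 0" "l 5 \<noteq> 0" "\<gamma> \<noteq> 0"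
proof -
  show *: "l (Suc 0) \<noteq> 0" "l 2 \<noteq> 0" "l 3 \<noteq> 0" "l 4 \<noteq> 0" "l 5 \<noteq> 0"
    by (simp_all add: nz)
  have "\<gamma> ^ 5 \<noteq> 0"
    using nz by (simp add: \<gamma>5)
  then show "\<gamma> \<noteq> 0"
    by (intro notI) simp
qed

lemma \<gamma>5_eq: "\<gamma>^5 = l 1 * l 2 * l 3 * l 4 * l 5"
  by (simp only: \<gamma>5 atLeastAtMost_1_5) simp

lemma l5: "l 5 = \<gamma>^5 / (l (Suc 0) * l 2 * l 3 * l 4)"
  using nonzero by (simp add: \<gamma>5_eq)

text \<open>Solving the root condition for \<open>l 5\<close> leaves rational functions of
  \<open>l 1\<close> to \<open>l 4\<close> and \<open>\<gamma>\<close>, whose identities can be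
  verified by clearing denominators.\<close>

lemma TW_entry_A_eq:
  "TW_entry_A l \<gamma> i j =
    [[l 1, (1 + \<gamma>^2 / (l 2 * l 4)) * (l 2 + \<gamma>^3 / (l 3 * l 4)),
      (1 + \<gamma>^3 / (l 2 * l 3 * l 4)) * (l 3 + \<gamma> + \<gamma>^2 / l 3),
      (1 + l 2 * l 4 / \<gamma>^2) * (l 3 + \<gamma>^3 / (l 2 * l 4)),
      l 2 * l 3 * l 4 / \<gamma>^2],
     [0, l 2, l 3 + \<gamma> + \<gamma>^2 / l 3, l 3 + \<gamma> + l 2 * l 3 * l 4 / \<gamma>^2, l 2 * l 3 * l 4 / \<gamma>^2],
     [0, 0, l 3, l 3 + l 2 * l 3 * l 4 / \<gamma>^2, l 2 * l 3 * l 4 / \<gamma>^2],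
     [0, 0, 0, l 4, l 4],
     [0, 0, 0, 0, \<gamma>^5 / (l 1 * l 2 * l 3 * l 4)]] ! (i - 1) ! (j - 1)"
proof -
  have nz': "l 1 * l 5 \<noteq> 0" "l 2 * l 3 * l 4 \<noteq> 0" "\<gamma>^2 \<noteq> 0"
    using nonzero by simp_all
  \<comment> \<open>The splitting \<open>\<gamma>^5 = \<gamma>^3 * \<gamma>^2\<close> matches the
    two quotients in which \<open>l 1 * l 5\<close> occurs.\<close>
  have "l 1 * l 5 * (l 2 * l 3 * l 4) = \<gamma>^3 * \<gamma>^2" "\<gamma>^3 * \<gamma>^2 = l 2 * l 3 * l 4 * (l 1 * l 5)"
    using \<gamma>5_eq by (simp_all only: power_add[symmetric] mult_ac) simp_all
  then have "l 1 * l 5 / \<gamma>^2 = \<gamma>^3 / (l 2 * l 3 * l 4)" "\<gamma>^3 / (l 1 * l 5) = l 2 * l 3 * l 4 / \<gamma>^2"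
    by (simp_all only: frac_eq_eq[OF nz'(3,2)] frac_eq_eq[OF nz'(1,3)])
  then show ?thesis
    unfolding TW_entry_A_def by (simp add: l5)
qed

lemma TW_A_mult_B: "TW_A l \<gamma> ** TW_B l \<gamma> = TW_AB l \<gamma>"
  unfolding TW_A_def TW_B_def TW_AB_def matrix5_mult
proof (rule matrix5_eqI)
  \<comment> \<open>The bounded quantifiers unfold into one concrete identity for each of the 25
    entries.\<close>
  have "\<forall>i\<in>{1..5}. \<forall>j\<in>{1..5}. (\<Sum>k\<in>{1..5}. TW_entry_A l \<gamma> i k * ((- 1) ^ (k + j) * TW_entry_A l \<gamma> (6 - k) (6 - j))) = TW_entry_AB l \<gamma> i j"
    unfolding atLeastAtMost_1_5 ball_simps
    by (intro conjI TrueI; simp add: TW_entry_A_eq TW_entry_AB_def Let_def;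
        (use nonzero in \<open>simp add: divide_simps\<close>)?; algebra?)
  then show "(\<Sum>k\<in>{1..5}. TW_entry_A l \<gamma> i k * ((- 1) ^ (k + j) * TW_entry_A l \<gamma> (6 - k) (6 - j))) = TW_entry_AB l \<gamma> i j" if "i \<in> {1..5}" "j \<in> {1..5}" for i j
    using that by blast
qed

text \<open>Together with \<open>TW_B_mult_AB\<close> this gives the braid relation, both sides
  being the half twist.\<close>

lemma TW_AB_mult_A: "TW_AB l \<gamma> ** TW_A l \<gamma> = TW_ABA \<gamma>"
  unfolding TW_A_def TW_ABA_def TW_AB_def matrix5_mult
proof (rule matrix5_eqI)
  have "\<forall>i\<in>{1..5}. \<forall>j\<in>{1..5}. (\<Sum>k\<in>{1..5}. TW_entry_AB l \<gamma> i k * TW_entry_A l \<gamma> k j) = (if i + j = 6 then (- 1) ^ (i + 1) * \<gamma>^3 else 0)"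
    unfolding atLeastAtMost_1_5 ball_simps
    by (intro conjI TrueI; simp add: TW_entry_A_eq TW_entry_AB_def Let_def;
        (use nonzero in \<open>simp add: divide_simps\<close>)?; algebra?)
  then show "(\<Sum>k\<in>{1..5}. TW_entry_AB l \<gamma> i k * TW_entry_A l \<gamma> k j) = (if i + j = 6 then (- 1) ^ (i + 1) * \<gamma>^3 else 0)" if "i \<in> {1..5}" "j \<in> {1..5}" for i j
    using that by blast
qed

lemma TW_B_mult_AB: "TW_B l \<gamma> ** TW_AB l \<gamma> = TW_ABA \<gamma>"
  unfolding TW_B_def TW_ABA_def TW_AB_def matrix5_mult
proof (rule matrix5_eqI)
  have "\<forall>i\<in>{1..5}. \<forall>j\<in>{1..5}. (\<Sum>k\<in>{1..5}. ((- 1) ^ (i + k) * TW_entry_A l \<gamma> (6 - i) (6 - k)) * TW_entry_AB l \<gamma> k j) = (if i + j = 6 then (- 1) ^ (i + 1) * \<gamma>^3 else 0)"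
    unfolding atLeastAtMost_1_5 ball_simps
    by (intro conjI TrueI; simp add: TW_entry_A_eq TW_entry_AB_def Let_def;
        (use nonzero in \<open>simp add: divide_simps\<close>)?; algebra?)
  then show "(\<Sum>k\<in>{1..5}. ((- 1) ^ (i + k) * TW_entry_A l \<gamma> (6 - i) (6 - k)) * TW_entry_AB l \<gamma> k j) = (if i + j = 6 then (- 1) ^ (i + 1) * \<gamma>^3 else 0)" if "i \<in> {1..5}" "j \<in> {1..5}" for i j
    using that by blast
qed

lemma mat_eq_matrix5: "mat k = matrix5 (\<lambda>i j. if i = j then k else 0)"
proof (rule vec5_eqI)
  have "\<forall>i\<in>{1..5}. \<forall>j\<in>{1..5}. (of_nat i = (of_nat j :: 5)) = (i = j)"
    unfolding atLeastAtMost_1_5 by simp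
  then have eq: "(of_nat i = (of_nat j :: 5)) = (i = j)" if "i \<in> {1..5}" "j \<in> {1..5}" for i j
    using that by blast
  show "(mat k :: complex^5^5) $ of_nat i $ of_nat j = matrix5 (\<lambda>i j. if i = j then k else 0) $ of_nat i $ of_nat j"
    if "i \<in> {1..5}" "j \<in> {1..5}" for i j
    using eq[OF that] by (simp only: mat_def vec_lambda_beta matrix5_nth[OF that] simp_thms)
qed

text \<open>Only \<open>k = 6 - i\<close> contributes, and \<open>i\<close> and \<open>6 - i\<close>
  have the same parity, so the signs cancel.\<close>

lemma TW_ABA_square: "TW_ABA \<gamma> ** TW_ABA \<gamma> = mat (\<gamma>^6)"
  unfolding TW_ABA_def matrix5_mult mat_eq_matrix5
proof (rule matrix5_eqI)
  have "\<forall>i\<in>{1..5}. \<forall>j\<in>{1..5}. (\<Sum>k\<in>{1..5}. (if i + k = 6 then (- 1) ^ (i + 1) * \<gamma>^3 else 0) *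
      (if k + j = 6 then (- 1) ^ (k + 1) * \<gamma>^3 else 0)) = (if i = j then \<gamma>^6 else 0)"
    unfolding atLeastAtMost_1_5 by (simp add: power_add[symmetric])
  then show "(\<Sum>k\<in>{1..5}. (if i + k = 6 then (- 1) ^ (i + 1) * \<gamma>^3 else 0) *
      (if k + j = 6 then (- 1) ^ (k + 1) * \<gamma>^3 else 0)) = (if i = j then \<gamma>^6 else 0)"
    if "i \<in> {1..5}" "j \<in> {1..5}" for i j
    using that by blast
qed

lemma mat_mult_vector: "mat k *v v = k *s v"
  by (simp add: vec_eq_iff matrix_vector_mult_def mat_def if_distrib[of "\<lambda>x. x * _"] cong: if_cong)

text \<open>The square of the half twist is a nonzero scalar, so the half twist has a right inverse;
  \<open>A\<close> and \<open>B\<close> are each a left factor of it, and for square matrices a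
  right inverse suffices.\<close>

lemma invertible_TW: "invertible (TW_A l \<gamma>)" "invertible (TW_B l \<gamma>)"
proof -
  have "TW_ABA \<gamma> ** (TW_ABA \<gamma> ** mat (inverse (\<gamma>^6))) = mat 1"
    using nonzero unfolding matrix_mul_assoc TW_ABA_square
    by (simp add: matrix_matrix_mult_def mat_def vec_eq_iff if_distrib[of "\<lambda>x. x * _"] cong: if_cong)
  then obtain T where T: "TW_ABA \<gamma> ** T = mat 1"
    by blast
  have "TW_A l \<gamma> ** (TW_B l \<gamma> ** TW_A l \<gamma> ** T) = mat 1"
    using T unfolding matrix_mul_assoc TW_A_mult_B TW_AB_mult_A .
  moreover have "TW_B l \<gamma> ** (TW_AB l \<gamma> ** T) = mat 1"
    using T unfolding matrix_mul_assoc TW_B_mult_AB .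
  ultimately show "invertible (TW_A l \<gamma>)" "invertible (TW_B l \<gamma>)"
    unfolding invertible_right_inverse by blast+
qed

text \<open>Regroup \<open>A B A B A B\<close> as \<open>(A B A) (B A B)\<close>, the square of the
  half twist.\<close>

lemma TW_AB_cubed: "TW_AB l \<gamma> ** (TW_AB l \<gamma> ** TW_AB l \<gamma>) = mat (\<gamma>^6)"
proof -
  have "TW_AB l \<gamma> ** (TW_AB l \<gamma> ** TW_AB l \<gamma>) =
      TW_AB l \<gamma> ** TW_A l \<gamma> ** (TW_B l \<gamma> ** TW_AB l \<gamma>)"
    by (simp only: TW_A_mult_B[symmetric] matrix_mul_assoc)
  then show ?thesis
    by (simp only: TW_AB_mult_A TW_B_mult_AB TW_ABA_square)
qed

end

section \<open>Eigenspaces of the product \<open>A B\<close>\<close>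

lemma GL_matrix:
  fixes X :: "complex^'n^'n"
  assumes "invertible X"
  shows "(\<lambda>v. X *v v) \<in> carrier (GL (*s))"
  using assms by (simp add: GL_def invertible_eq_bij)

text \<open>Projection to the coordinates \<open>i\<close> and \<open>j\<close> is injective on
  \<open>W\<close>.\<close>

lemma vec_dim_le_2I:
  fixes W :: "('a::field^'n) set"
  assumes W: "vec.subspace W" and zero: "\<And>v. v \<in> W \<Longrightarrow> v $ i = 0 \<Longrightarrow> v $ j = 0 \<Longrightarrow> v = 0"
  shows "vec.dim W \<le> 2"
proof -
  define T where "T = (\<lambda>v :: 'a^'n. (\<chi> k :: 2. if k = 1 then v $ i else v $ j))"
  have lin: "Vector_Spaces.linear (*s) (*s) T"
    by unfold_locales (auto simp: T_def vec_eq_iff)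
  have "inj_on T W"
  proof (rule inj_onI)
    fix v w
    assume vw: "v \<in> W" "w \<in> W" "T v = T w"
    then have "T v $ 1 = T w $ 1" "T v $ 2 = T w $ 2"
      by simp_all
    then have "v $ i = w $ i" "v $ j = w $ j"
      by (simp_all add: T_def)
    then have "v - w = 0"
      using vw by (intro zero vec.subspace_diff[OF W]) auto
    then show "v = w"
      by simp
  qed
  then have "vec.dim (T ` W) = vec.dim W"
    using W by (intro vec.dim_image_eq[OF lin]) (simp add: vec.span_eq_iff[THEN iffD2])
  moreover have "vec.dim (T ` W) \<le> vec.dim (UNIV :: ('a^2) set)"
    by (rule vec.dim_subset) simp
  moreover have "vec.dim (UNIV :: ('a^2) set) = 2"
    by (simp only: vec_dim_card) simp
  ultimately show ?thesis
    by linarith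
qed

context TW_parameters
begin

lemma TW_AB_eigenvector:
  assumes "TW_AB l \<gamma> *v v = z *s v"
  defines "u \<equiv> l 1 * l 2 * l 3 * l 4 / \<gamma>^2"
  shows "z * v $ 1 = u * v $ 5"
    and "z * v $ 2 = - (\<gamma>^3 / l 4) * v $ 4 + u * v $ 5"
    and "(z - \<gamma>^3 / l 3) * v $ 3 = - (l 2 * \<gamma> + \<gamma>^3 / l 4) * v $ 4 + u * v $ 5"
proof -
  have "(\<Sum>k\<in>{1..5}. TW_entry_AB l \<gamma> i k * v $ of_nat k) = z * v $ of_nat i" if "i \<in> {1..5}" for i
  proof -
    have "(\<Sum>k\<in>{1..5}. TW_entry_AB l \<gamma> i k * v $ of_nat k) =
        (\<Sum>k\<in>{1..5}. TW_AB l \<gamma> $ of_nat i $ of_nat k * v $ of_nat k)"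
      unfolding TW_AB_def by (intro sum.cong) (simp_all only: matrix5_nth that)
    also have "\<dots> = (TW_AB l \<gamma> *v v) $ of_nat i"
      by (simp add: matrix_vector_mult_def sum_5_of_nat)
    finally show ?thesis
      by (simp add: assms)
  qed
  note row = this[unfolded atLeastAtMost_1_5]
  show "z * v $ 1 = u * v $ 5" "z * v $ 2 = - (\<gamma>^3 / l 4) * v $ 4 + u * v $ 5"
    using row[of 1] row[of 2] by (simp_all add: TW_entry_AB_def Let_def u_def)
  \<comment> \<open>In the third row the antidiagonal entry lies on the diagonal, so it combines
    with \<open>z\<close>.\<close>
  have "\<gamma>^3 / l 3 * v $ 3 + (- (l 2 * \<gamma> + \<gamma>^3 / l 4) * v $ 4 + u * v $ 5) = z * v $ 3"
    using row[of 3] by (simp add: TW_entry_AB_def Let_def u_def)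
  then show "(z - \<gamma>^3 / l 3) * v $ 3 = - (l 2 * \<gamma> + \<gamma>^3 / l 4) * v $ 4 + u * v $ 5"
    unfolding left_diff_distrib by (metis add_diff_cancel_left')
qed

text \<open>By the first three rows, an eigenvector for \<open>z\<close> is determined by its last two
  coordinates, except for \<open>z = \<gamma>\<^sup>3 / \<lambda>\<^sub>3\<close>, where the third row loses \<open>v\<^sub>3\<close> and instead
  expresses \<open>v\<^sub>5\<close> by \<open>v\<^sub>4\<close>.\<close>

lemma dim_eigenspace_TW_AB: "vec.dim (eigenspace (*s) ((*v) (TW_AB l \<gamma>)) z) \<le> 2"
proof -
  let ?W = "eigenspace (*s) ((*v) (TW_AB l \<gamma>)) z"
  have sub: "vec.subspace ?W"
    by (rule subspace_eigenspace) simp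
  show ?thesis
  proof (cases "z = 0")
    case True
    have "?W \<subseteq> {0}"
    proof
      fix v assume "v \<in> ?W"
      \<comment> \<open>The kernel is trivial because the cube of the matrix is a nonzero
        scalar.\<close>
      then have "TW_AB l \<gamma> *v v = 0"
        using True by (simp add: eigenspace_def)
      then have "mat (\<gamma>^6) *v v = 0"
        by (simp add: TW_AB_cubed[symmetric] matrix_vector_mul_assoc[symmetric])
      then show "v \<in> {0}"
        using nonzero by (simp add: mat_mult_vector)
    qed
    then show ?thesis
      by (rule order_trans[OF vec.dim_subset]) simp
  next
    case False
    define j :: 5 where "j = (if z = \<gamma>^3 / l 3 then 3 else 5)"
    show ?thesis
    proof (rule vec_dim_le_2I[OF sub, of 4 j])
      fix v assume "v \<in> ?W" and v: "v $ 4 = 0" "v $ j = 0"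
      then have "TW_AB l \<gamma> *v v = z *s v"
        by (simp add: eigenspace_def)
      note rows = TW_AB_eigenvector[OF this]
      \<comment> \<open>One of the two is given by the choice of \<open>j\<close>. With
        \<open>v $ 4 = 0\<close> the third row yields the other: \<open>u * v $ 5 = 0\<close> in the
        exceptional case, \<open>(z - \<gamma>^3 / l 3) * v $ 3 = 0\<close> otherwise.\<close>
      have "v $ 3 = 0" "v $ 5 = 0"
        using rows(3) v nonzero by (auto simp: j_def split: if_splits)
      then have "v $ 1 = 0" "v $ 2 = 0"
        using rows(1,2) v False by auto
      with \<open>v $ 3 = 0\<close> v \<open>v $ 5 = 0\<close> show "v = 0"
        by (simp add: vec_eq_iff forall_5)
    qed
  qed
qed

lemma TW_AB_apply: "TW_A l \<gamma> *v (TW_B l \<gamma> *v v) = TW_AB l \<gamma> *v v"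
  by (simp add: matrix_vector_mul_assoc TW_A_mult_B)

lemma TW_representation_exists: "\<exists>\<rho>. TW_representation l \<gamma> \<rho>"
proof -
  have "((*v) (TW_A l \<gamma>)) \<circ> ((*v) (TW_B l \<gamma>)) \<circ> ((*v) (TW_A l \<gamma>)) =
      ((*v) (TW_B l \<gamma>)) \<circ> ((*v) (TW_A l \<gamma>)) \<circ> ((*v) (TW_B l \<gamma>))"
    by (simp only: fun_eq_iff comp_apply TW_AB_apply)
      (simp add: matrix_vector_mul_assoc TW_AB_mult_A TW_B_mult_AB)
  then show ?thesis
    unfolding TW_representation_def
    using B3_representation_exists[OF vec.vector_space_axioms GL_matrix[OF invertible_TW(1)] GL_matrix[OF invertible_TW(2)]]
    by blast
qed

lemma TW_admits_standard_extension:
  assumes "TW_representation l \<gamma> \<rho>"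
  shows "admits_standard_extension (*s) \<rho>"
proof (rule standard_extension_if_eigenspaces_small)
  have \<rho>: "representation B3 (*s) \<rho>" "\<rho> (B3_gen Sigma1) (\<rho> (B3_gen Sigma2) v) = TW_AB l \<gamma> *v v" for v
    using assms by (simp_all add: TW_representation_def TW_AB_apply)
  show "representation B3 (*s) \<rho>"
    by (rule \<rho>)
  show "vec.dim (UNIV :: (complex^5) set) = 5"
    by (simp only: vec_dim_card) simp
  let ?h = "\<lambda>v. \<rho> (B3_gen Sigma1) (\<rho> (B3_gen Sigma2) v)"
  show "?h (?h (?h v)) = \<gamma>^6 *s v" for v
    by (simp only: \<rho> matrix_vector_mul_assoc TW_AB_cubed mat_mult_vector)
  show "vec.dim (eigenspace (*s) ?h z) \<le> 2" for z
    unfolding \<rho> by (rule dim_eigenspace_TW_AB)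
qed

end

section \<open>Irreducible representations\<close>

locale complex_endomorphism = Vector_Spaces.linear scl scl T
  for scl :: "complex \<Rightarrow> 'v::ab_group_add \<Rightarrow> 'v" and T
begin

text \<open>The vector \<open>p(T) v\<close>, computed by Horner's scheme.\<close>

definition poly_apply :: "complex poly \<Rightarrow> 'v \<Rightarrow> 'v" where
  "poly_apply p v = fold_coeffs (\<lambda>a w. scl a v + T w) p 0"

lemma poly_apply_0 [simp]: "poly_apply 0 v = 0"
  by (simp add: poly_apply_def)

lemma poly_apply_pCons [simp]: "poly_apply (pCons a p) v = scl a v + T (poly_apply p v)"
  \<comment> \<open>The case of \<open>pCons 0 0\<close> is separate because it is the zero
    polynomial, with no coefficients to fold over.\<close>
  by (cases "p = 0"; cases "a = 0") (simp_all add: poly_apply_def zero)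

lemma poly_apply_add: "poly_apply (p + q) v = poly_apply p v + poly_apply q v"
  by (induction p q rule: poly_induct2) (simp_all add: add vs1.scale_left_distrib)

lemma poly_apply_smult: "poly_apply (smult a p) v = scl a (poly_apply p v)"
  by (induction p) (simp_all add: scale vs1.scale_right_distrib)

lemma poly_apply_diff: "poly_apply (p - q) v = poly_apply p v - poly_apply q v"
  using poly_apply_add[of "p - q" q v] by simp

text \<open>Otherwise the vectors \<open>v\<close>, \<open>T v\<close>, \<open>T (T v)\<close>, ...
  would be linearly independent, more of them than the dimension allows.\<close>

lemma annihilating_poly_exists:
  assumes "finite_dimensional_vector_space scl B"
  shows "\<exists>p. p \<noteq> 0 \<and> poly_apply p v = 0"
proof (rule ccontr)
  interpret fd: finite_dimensional_vector_space scl B by (rule assms)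
  assume "\<not> ?thesis"
  then have nz: "p = 0" if "poly_apply p v = 0" for p
    using that by blast
  let ?x = "\<lambda>i. poly_apply (monom 1 i) v"
  have notin: "?x n \<notin> vs1.span (?x ` {..<n})" for n
  proof
    assume "?x n \<in> vs1.span (?x ` {..<n})"
    \<comment> \<open>If the \<open>n\<close>-th power lay in the span of the earlier ones, it would
      be \<open>q(T) v\<close> with vanishing \<open>n\<close>-th coefficient, and
      \<open>monom 1 n - q\<close> would be a nonzero annihilating polynomial.\<close>
    also have "\<dots> \<subseteq> {poly_apply q v |q. coeff q n = 0}"
    proof (rule vs1.span_minimal)
      show "vs1.subspace {poly_apply q v |q. coeff q n = 0}"
      proof (rule vs1.subspaceI)
        show "0 \<in> {poly_apply q v |q. coeff q n = 0}"
          using poly_apply_0[of v] coeff_0[of n] by (metis (mono_tags, lifting) mem_Collect_eq)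
      next
        fix x y assume "x \<in> {poly_apply q v |q. coeff q n = 0}" "y \<in> {poly_apply q v |q. coeff q n = 0}"
        then obtain p q where "x = poly_apply p v" "coeff p n = 0" "y = poly_apply q v" "coeff q n = 0"
          by blast
        then have "x + y = poly_apply (p + q) v" "coeff (p + q) n = 0"
          by (simp_all add: poly_apply_add)
        then show "x + y \<in> {poly_apply q v |q. coeff q n = 0}"
          by blast
      next
        fix a x assume "x \<in> {poly_apply q v |q. coeff q n = 0}"
        then obtain p where "x = poly_apply p v" "coeff p n = 0"
          by blast
        then have "scl a x = poly_apply (smult a p) v" "coeff (smult a p) n = 0"
          by (simp_all add: poly_apply_smult)
        then show "scl a x \<in> {poly_apply q v |q. coeff q n = 0}"
          by blast
      qed
      have "coeff (monom (1 :: complex) i) n = 0" if "i < n" for i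
        using that by simp
      then show "?x ` {..<n} \<subseteq> {poly_apply q v |q. coeff q n = 0}"
        by blast
    qed
    finally obtain q where q: "?x n = poly_apply q v" "coeff q n = 0"
      by blast
    then have "monom 1 n - q = 0"
      by (intro nz) (simp add: poly_apply_diff)
    then have "coeff (monom 1 n - q) n = 0"
      by simp
    with q(2) show False
      by simp
  qed
  have ind: "\<not> vs1.dependent (?x ` {..<n}) \<and> card (?x ` {..<n}) = n" for n
  proof (induction n)
    case (Suc n)
    have "?x n \<notin> ?x ` {..<n}"
    proof
      assume "?x n \<in> ?x ` {..<n}"
      then have "?x n \<in> vs1.span (?x ` {..<n})"
        by (rule vs1.span_base)
      with notin[of n] show False
        by (rule notE)
    qed
    moreover have "?x ` {..<Suc n} = insert (?x n) (?x ` {..<n})"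
      by (simp add: lessThan_Suc)
    moreover have "finite (?x ` {..<n})"
      by simp
    ultimately show ?case
      using vs1.independent_insertI[OF notin[of n] conjunct1[OF Suc]] Suc by (simp only: card_insert_disjoint) simp
  qed (simp add: vs1.independent_empty)
  let ?X = "?x ` {..<Suc fd.dimension}"
  have "vs1.dim ?X = Suc fd.dimension"
    using vs1.dim_eq_card_independent[OF conjunct1[OF ind]] conjunct2[OF ind] by metis
  moreover have "vs1.dim ?X \<le> fd.dimension"
    by (rule fd.dim_subset_UNIV)
  ultimately show False
    by linarith
qed

text \<open>Split off a root: \<open>p = (X - r) q\<close>. Either \<open>q(T) v\<close> is an
  eigenvector for \<open>r\<close>, or it is zero and \<open>q\<close> is an annihilating polynomial
  of smaller degree.\<close>

lemma eigenvector_if_annihilated: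
  assumes "p \<noteq> 0" "poly_apply p v = 0" "v \<noteq> 0"
  shows "\<exists>z w. w \<noteq> 0 \<and> T w = scl z w"
  using assms(1,2)
proof (induction "degree p" arbitrary: p rule: less_induct)
  case less
  have "degree p \<noteq> 0"
  proof
    assume "degree p = 0"
    then obtain a where "p = [:a:]"
      by (rule degree_eq_zeroE)
    with less.prems assms(3) show False
      by (simp add: zero)
  qed
  then obtain r where "poly p r = 0"
    using alg_closed_imp_poly_has_root[of p] by auto
  then obtain q where q: "p = [:- r, 1:] * q"
    by (auto simp: poly_eq_0_iff_dvd)
  with less.prems have "q \<noteq> 0"
    by auto
  then have "degree q < degree p"
    unfolding q by (subst degree_mult_eq) auto
  have "poly_apply p v = T (poly_apply q v) - scl r (poly_apply q v)"
    by (simp add: q poly_apply_diff poly_apply_smult)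
  then have "T (poly_apply q v) = scl r (poly_apply q v)"
    using less.prems by simp
  then show ?case
    using less.hyps[OF \<open>degree q < degree p\<close> \<open>q \<noteq> 0\<close>] by blast
qed

lemma eigenvector_exists:
  assumes "finite_dimensional_vector_space scl B" and "(UNIV :: 'v set) \<noteq> {0}"
  shows "\<exists>z w. w \<noteq> 0 \<and> T w = scl z w"
proof -
  obtain v :: 'v where "v \<noteq> 0"
    using assms(2) by blast
  then show ?thesis
    using annihilating_poly_exists[OF assms(1)] eigenvector_if_annihilated by blast
qed

end

text \<open>Reduces invariance under all of \<open>B3\<close> to the two generators. By dimension a
  generator maps \<open>W\<close> onto itself, so its inverse preserves \<open>W\<close> too, and
  then so does every word.\<close>

lemma irreducible_invariant_subspace:
  assumes irr: "irreducible_representation B3 scl \<rho>"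
    and fin: "finite_dimensional_vector_space scl B"
    and W: "module.subspace scl W"
    and inv: "\<And>a v. v \<in> W \<Longrightarrow> \<rho> (B3_gen a) v \<in> W"
  shows "W = {0} \<or> W = UNIV"
proof -
  interpret fd: finite_dimensional_vector_space scl B by (rule fin)
  interpret fp: finite_dimensional_vector_space_pair scl B scl B ..
  have \<rho>: "representation B3 scl \<rho>"
    using irr by (simp add: irreducible_representation_def)
  interpret GL: group "GL scl" by (rule group_GL) (rule fd.vector_space_axioms)
  let ?F = "\<lambda>a. \<rho> (B3_gen a)"
  have F: "?F a \<in> carrier (GL scl)" for a
    using B3_representation_gens(1,2)[OF \<rho>] by (cases a) auto
  have inv': "inv_into UNIV (?F a) v \<in> W" if "v \<in> W" for a v
  proof -
    have lin: "Vector_Spaces.linear scl scl (?F a)" and bij: "bij (?F a)"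
      using GL_linear_bij[OF F] by auto
    have "?F a ` W = W"
    proof (rule fd.subspace_dim_equal)
      show "fd.subspace (?F a ` W)"
        by (rule fp.linear_subspace_image[OF lin W])
      show "fd.dim W \<le> fd.dim (?F a ` W)"
        using fp.dim_image_eq[OF lin inj_on_subset[OF bij_is_inj[OF bij] subset_UNIV], of W] by simp
    qed (use W inv in auto)
    with that have "v \<in> ?F a ` W"
      by (simp only:)
    then obtain w where "w \<in> W" "v = ?F a w"
      by (elim imageE)
    then show ?thesis
      using bij by (simp add: bij_is_inj)
  qed
  have eval: "eval_word (GL scl) ?F u v \<in> W" if "v \<in> W" for u v
  proof (induction u)
    case Nil
    show ?case using that by (simp add: GL_one)
  next
    case (Cons x u)
    then show ?case
      using inv inv' by (cases x) (auto simp: GL_mult inv_GL[OF fd.vector_space_axioms F])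
  qed
  have "\<rho> x v \<in> W" if "x \<in> carrier B3" "v \<in> W" for x v
  proof -
    have "\<rho> \<in> hom (presented_group B3_relations) (GL scl)"
      using \<rho> by (simp add: representation_def B3_def)
    then have "\<rho> (word_class B3_relations u) = eval_word (GL scl) ?F u" for u
      unfolding B3_gen_def by (rule GL.presented_group_hom_eval_word)
    then show ?thesis
      using that eval by (auto simp: B3_def presented_group_def)
  qed
  then show ?thesis
    using irr W by (auto simp: irreducible_representation_def)
qed

section \<open>The half twist in an irreducible representation\<close>

lemma irreducible_dim_5_admits_standard_extension:
  fixes scl :: "complex \<Rightarrow> 'v::ab_group_add \<Rightarrow> 'v"
  assumes irr: "irreducible_representation B3 scl \<rho>"
    and dim: "vector_space.dim scl (UNIV :: 'v set) = 5"
  shows "admits_standard_extension scl \<rho>"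
proof -
  define f where "f = \<rho> (B3_gen Sigma1)"
  define g where "g = \<rho> (B3_gen Sigma2)"
  have \<rho>: "representation B3 scl \<rho>"
    using irr by (simp add: irreducible_representation_def)
  note gens = B3_representation_gens[OF \<rho>, folded f_def g_def]
  have V: "vector_space scl"
    using \<rho> by (simp add: representation_def)
  obtain B where fin: "finite_dimensional_vector_space scl (B :: 'v set)"
    using finite_dimensional_if_dim_pos[OF V] dim by auto
  interpret fd: finite_dimensional_vector_space scl B by (rule fin)
  interpret f: Vector_Spaces.linear scl scl f by (rule GL_linear_bij[OF gens(1)])
  interpret g: Vector_Spaces.linear scl scl g by (rule GL_linear_bij[OF gens(2)])
  have f0: "f v = 0 \<longleftrightarrow> v = 0" and g0: "g v = 0 \<longleftrightarrow> v = 0" for v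
    using GL_linear_bij(2)[OF gens(1)] GL_linear_bij(2)[OF gens(2)] f.zero g.zero by (metis bij_is_inj injD)+
  have invariant: "W = {0} \<or> W = UNIV"
    if "fd.subspace W" "\<And>v. v \<in> W \<Longrightarrow> f v \<in> W" "\<And>v. v \<in> W \<Longrightarrow> g v \<in> W" for W
  proof (rule irreducible_invariant_subspace[OF irr fin that(1)])
    show "\<rho> (B3_gen a) v \<in> W" if "v \<in> W" for a v
      using that \<open>\<And>v. v \<in> W \<Longrightarrow> f v \<in> W\<close> \<open>\<And>v. v \<in> W \<Longrightarrow> g v \<in> W\<close>
      by (cases a) (simp_all add: f_def g_def)
  qed
  have braid: "f (g (f v)) = g (f (g v))" for v
    using fun_cong[OF gens(3), of v] by simp
  define s where "s v = f (g (f v))" for v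
  interpret s: Vector_Spaces.linear scl scl s
    by unfold_locales (simp_all add: s_def f.add g.add f.scale g.scale)
  \<comment> \<open>Moving past the half twist \<open>s\<close> exchanges the generators, so
    \<open>s \<circ> s\<close> commutes with both.\<close>
  have fs: "f (s v) = s (g v)" and gs: "g (s v) = s (f v)" for v
    by (simp_all only: s_def braid)
  interpret ss: complex_endomorphism scl "\<lambda>v. s (s v)"
    by unfold_locales (simp_all add: s.add s.scale)
  have "(UNIV :: 'v set) \<noteq> {0}"
    using irr by (simp add: irreducible_representation_def)
  then obtain d w where "w \<noteq> 0" "s (s w) = scl d w"
    using ss.eigenvector_exists[OF fin] by blast
  \<comment> \<open>Schur's lemma: this nonzero eigenspace of a map commuting with the generators is
    invariant, hence the whole space.\<close>
  moreover have "eigenspace scl (\<lambda>v. s (s v)) d = {0} \<or> eigenspace scl (\<lambda>v. s (s v)) d = UNIV"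
  proof (rule invariant)
    show "fd.subspace (eigenspace scl (\<lambda>v. s (s v)) d)"
      by (rule subspace_eigenspace) (rule ss.linear_axioms)
    fix v assume "v \<in> eigenspace scl (\<lambda>v. s (s v)) d"
    then have v: "s (s v) = scl d v"
      by (simp add: eigenspace_def)
    show "f v \<in> eigenspace scl (\<lambda>v. s (s v)) d" "g v \<in> eigenspace scl (\<lambda>v. s (s v)) d"
      by (simp_all add: eigenspace_def fs[symmetric] gs[symmetric] v f.scale g.scale)
  qed
  ultimately have ssd: "s (s v) = scl d v" for v
    by (auto simp: eigenspace_def)
  obtain m where m: "m ^ 2 = d"
    using nth_root_exists[of 2 d] by auto
  have "d \<noteq> 0"
    using \<open>w \<noteq> 0\<close> \<open>s (s w) = scl d w\<close> by (auto simp: s_def f0 g0)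
  then have "m \<noteq> 0"
    using m by auto
  have "UNIV = {x + y |x y. x \<in> eigenspace scl s m \<and> y \<in> eigenspace scl s (- m)}"
  proof -
    have "v \<in> {x + y |x y. x \<in> eigenspace scl s m \<and> y \<in> eigenspace scl s (- m)}" for v
    proof -
      \<comment> \<open>These are the projections \<open>(1 + s / m) / 2\<close> and, for
        \<open>y\<close>, \<open>(1 - s / m) / 2\<close> of \<open>v\<close> to the eigenspaces of
        \<open>m\<close> and \<open>- m\<close>.\<close>
      define x where "x = scl (1/2) v + scl (1 / (2 * m)) (s v)"
      define y where "y = scl (1/2) v - scl (1 / (2 * m)) (s v)"
      have "x \<in> eigenspace scl s m" "y \<in> eigenspace scl s (- m)"
        using \<open>m \<noteq> 0\<close>
        by (simp_all add: eigenspace_def x_def y_def s.add s.diff s.scale ssd m[symmetric]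
            fd.scale_right_distrib fd.scale_right_diff_distrib power2_eq_square)
      moreover have "v = x + y"
        by (simp add: x_def y_def fd.scale_left_distrib[symmetric])
      ultimately show ?thesis by blast
    qed
    then show ?thesis by blast
  qed
  then have "5 \<le> fd.dim (eigenspace scl s m) + fd.dim (eigenspace scl s (- m))"
    using fd.dim_sums_Int[of "eigenspace scl s m" "eigenspace scl s (- m)"] dim
      subspace_eigenspace[OF s.linear_axioms] by simp
  then have "3 \<le> fd.dim (eigenspace scl s m) \<or> 3 \<le> fd.dim (eigenspace scl s (- m))"
    by linarith
  then obtain n where n: "n = m \<or> n = - m" "3 \<le> fd.dim (eigenspace scl s n)"
    by blast
  then have "n \<noteq> 0"
    using \<open>m \<noteq> 0\<close> by auto
  let ?h = "\<lambda>v. f (g v)"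
  interpret h: Vector_Spaces.linear scl scl ?h
    by unfold_locales (simp_all add: f.add g.add f.scale g.scale)
  have small: "fd.dim (eigenspace scl ?h z) \<le> 2" for z
  proof (rule ccontr)
    let ?E = "eigenspace scl ?h z" and ?S = "eigenspace scl s n"
    assume "\<not> fd.dim ?E \<le> 2"
    moreover have "fd.dim {x + y |x y. x \<in> ?E \<and> y \<in> ?S} \<le> fd.dim UNIV"
      by (rule fd.dim_subset) simp
    moreover have "fd.dim {x + y |x y. x \<in> ?E \<and> y \<in> ?S} + fd.dim (?E \<inter> ?S) = fd.dim ?E + fd.dim ?S"
      by (rule fd.dim_sums_Int[OF subspace_eigenspace[OF h.linear_axioms] subspace_eigenspace[OF s.linear_axioms]])
    \<comment> \<open>Two subspaces of dimension at least 3 must meet nontrivially in dimension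
      5.\<close>
    ultimately have "fd.dim (?E \<inter> ?S) \<noteq> 0"
      using n(2) dim by linarith
    then have "\<not> ?E \<inter> ?S \<subseteq> {0}"
      by (simp only: fd.dim_eq_0 simp_thms)
    then obtain v where v: "v \<noteq> 0" "f (g v) = scl z v" "s v = scl n v"
      by (auto simp: eigenspace_def)
    have "z \<noteq> 0"
      using v by (auto simp: f0 g0)
    \<comment> \<open>Since \<open>s = g f g\<close>, a common eigenvector satisfies
      \<open>s v = g (scl z v)\<close>. So it is an eigenvector of \<open>g\<close>, and then of
      \<open>f\<close> because \<open>f (g v) = scl z v\<close>.\<close>
    have "scl z (g v) = scl n v"
      using v by (simp add: s_def braid g.scale)
    then have "scl (1 / z) (scl z (g v)) = scl (1 / z) (scl n v)"
      by simp
    then have gv: "g v = scl (n / z) v"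
      using \<open>z \<noteq> 0\<close> by simp
    then have "scl (n / z) (f v) = scl z v"
      using v by (simp add: f.scale)
    then have "scl (z / n) (scl (n / z) (f v)) = scl (z / n) (scl z v)"
      by simp
    then have fv: "f v = scl (z / n * z) v"
      using \<open>z \<noteq> 0\<close> \<open>n \<noteq> 0\<close> by simp
    have "fd.span {v} = {0} \<or> fd.span {v} = UNIV"
    proof (rule invariant)
      show "f x \<in> fd.span {v}" "g x \<in> fd.span {v}" if "x \<in> fd.span {v}" for x
        using that by (auto simp: fd.span_singleton f.scale g.scale fv gv)
    qed simp
    moreover have "fd.span {v} \<noteq> {0}"
      using v(1) fd.span_base[of v "{v}"] by auto
    moreover have "fd.span {v} \<noteq> UNIV"
    proof
      assume "fd.span {v} = UNIV"
      then have "fd.dim {v} = 5"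
        using dim by (metis fd.dim_span)
      then show False
        by (simp add: v(1))
    qed
    ultimately show False by blast
  qed
  \<comment> \<open>The product \<open>(f g)\<^sup>3\<close> regroups as
    \<open>(f g f) (g f g)\<close>, which is \<open>s \<circ> s\<close>.\<close>
  have "?h (?h (?h v)) = scl d v" for v
    using ssd[of v] by (simp only: s_def braid)
  then show ?thesis
    by (intro standard_extension_if_eigenspaces_small[OF \<rho> dim, folded f_def g_def] small)
qed

text \<open>The existence claim keeps the assertion about all \<open>\<rho>\<close> from being
  vacuous: it says that the matrices are invertible and satisfy the braid relation.\<close>

theorem proposition5p6:
  shows "(\<forall>(l :: nat \<Rightarrow> complex) (\<gamma> :: complex).
            (\<forall>i\<in>{1..5}. l i \<noteq> 0) \<and> \<gamma> ^ 5 = (\<Prod>i=1..5. l i) \<longrightarrow>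
              (\<exists>\<rho>. TW_representation l \<gamma> \<rho>) \<and>
              (\<forall>\<rho>. TW_representation l \<gamma> \<rho> \<longrightarrow> admits_standard_extension (\<lambda>c v. c *s v) \<rho>))
       \<and> (\<forall>(scl :: complex \<Rightarrow> 'v::ab_group_add \<Rightarrow> 'v) (\<rho> :: braid_gen word set \<Rightarrow> 'v \<Rightarrow> 'v).
            irreducible_representation B3 scl \<rho> \<and> vector_space.dim scl (UNIV :: 'v set) = 5 \<longrightarrow>
              admits_standard_extension scl \<rho>)"
proof (intro conjI allI impI)
  fix l :: "nat \<Rightarrow> complex" and \<gamma> :: complex
  assume "(\<forall>i\<in>{1..5}. l i \<noteq> 0) \<and> \<gamma> ^ 5 = (\<Prod>i=1..5. l i)"
  then interpret TW_parameters l \<gamma>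
    by unfold_locales auto
  show "\<exists>\<rho>. TW_representation l \<gamma> \<rho>"
    by (rule TW_representation_exists)
  show "admits_standard_extension (\<lambda>c v. c *s v) \<rho>" if "TW_representation l \<gamma> \<rho>" for \<rho>
    using that by (rule TW_admits_standard_extension)
qed (blast intro: irreducible_dim_5_admits_standard_extension)

end
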